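(* Let $V \subseteq \mathbb{C}^n$ be a complex vector subspace not contained in any coordinate hyperplane, and set $X := V \cap (\mathbb{C}^* )^n$. For $S \subseteq [n]$ let $r_V(S)$ denote the complex dimension of the image of $V$ under the coordinate projection $\mathbb{C}^n \to \mathbb{C}^S$. Then \[ \dim_\mathbb{R} \mathcal{A}(X) = \min \sum_{i=1}^k \bigl(2\, r_V(P_i) - 1\bigr), \] where the minimum is taken over all partitions $\{P_1,\ldots,P_k\}$ of $[n]=\{1,\ldots,n\}$.
   Context: The map $\operatorname{Log}:(\mathbb{C}^* )^n \to \mathbb{R}^n$ is $z \mapsto (\log|z_1|,\ldots,\log|z_n|)$, and the amoeba of $X$ is $\mathcal{A}(X) := \operatorname{Log}(X)$. An open dense subset (in the Euclidean topology) of $\mathcal{A}(X)$ is a real manifold, and $\dim_\mathbb{R}\mathcal{A}(X)$ denotes the dimension of this manifold. A partition of a finite set is a set of pairwise disjoint nonempty subsets (parts) whose union is the whole set. The function $r_V$ is the rank function of the matroid $M_V$ that $V$ defines on $[n]$. *)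

theory Defs
  imports "HOL-Analysis.Analysis"
begin

text \<open>The index set $[n]$ is a finite type \<open>'n\<close>, so $\mathbb{C}^n$ is \<open>complex ^ 'n\<close>.
  Its complex vector space structure is the one of the locale interpretation \<open>vec\<close>
  (scalar multiplication \<open>*s\<close>); the unqualified \<open>subspace\<close> and \<open>dim\<close> would be real.\<close>

definition torus :: "(complex ^ 'n) set" where
  "torus = {z. \<forall>i. z $ i \<noteq> 0}"

definition Log :: "complex ^ 'n \<Rightarrow> real ^ 'n" where
  "Log z = (\<chi> i. ln (cmod (z $ i)))"

definition amoeba :: "(complex ^ 'n) set \<Rightarrow> (real ^ 'n) set" where
  "amoeba X = Log ` X"

text \<open>The target $\mathbb{C}^S$ of the coordinate projection is realised inside
  $\mathbb{C}^n$, as the vectors that vanish outside \<open>S\<close>.\<close>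

definition coord_proj :: "'n set \<Rightarrow> complex ^ 'n \<Rightarrow> complex ^ 'n" where
  "coord_proj S v = (\<chi> i. if i \<in> S then v $ i else 0)"

definition proj_rank :: "(complex ^ 'n) set \<Rightarrow> 'n set \<Rightarrow> nat" where
  "proj_rank V S = vec.dim (coord_proj S ` V)"

definition manifold_of_dim :: "nat \<Rightarrow> 'a topology \<Rightarrow> bool" where
  "manifold_of_dim d M \<longleftrightarrow>
     Hausdorff_space M \<and> second_countable M \<and>
     (\<forall>x \<in> topspace M. \<exists>U W. openin M U \<and> x \<in> U \<and> openin (Euclidean_space d) W \<and>
        subtopology M U homeomorphic_space subtopology (Euclidean_space d) W)"

text \<open>The dimension of a set that has a relatively open dense subset which is a manifold.
  The dimension of that manifold does not depend on the choice of the subset: two such subsets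
  of a nonempty set intersect in a nonempty open set, so invariance of dimension applies. For the
  empty set, and for sets without such a subset, the value is unspecified.\<close>

definition real_dim :: "(real ^ 'n) set \<Rightarrow> nat" where
  "real_dim A = (THE d. \<exists>U. openin (top_of_set A) U \<and> top_of_set A closure_of U = A \<and>
                              manifold_of_dim d (top_of_set U))"

end

theory Submission
  imports Defs "HOL-Homology.Invariance_of_Domain" "HOL-Computational_Algebra.Polynomial"
begin

text \<open>
  The differential of \<open>Log\<close> at \<open>y \<in> V\<close> is \<open>v \<mapsto> (Re (v $ i / y $ i))\<^sub>i\<close>. In the real dual of
  \<open>V\<close>, the \<open>i\<close>-th component spans the intersection of the plane of real functionals factoring
  through the \<open>i\<close>-th coordinate with the hyperplane of functionals vanishing at \<open>\<i> y\<close>. For a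
  generic hyperplane, Lovasz's theorem on the Dilworth truncation says that these intersections span
  a space of dimension \<open>Min (\<Sum>B\<in>Q. 2 * r B - 1)\<close> over all partitions \<open>Q\<close>; for every hyperplane of
  this form it is an upper bound.

  Genericity is expressed by derivations of the field of real numbers: a point is generic over a
  countable set of constants if derivations killing the constants move it in every direction. Such
  derivations exist because those of subrings extend. They replace perturbation arguments in
  Lovasz's theorem, and they yield a Sard theorem: if \<open>q = ((cmod (y $ i))\<^sup>2)\<^sub>i\<close> is generic on a set
  of coordinates, then differentiating this identity shows that \<open>Log\<close> has full rank there at every
  point \<open>y\<close> of the fibre. The amoeba is closed, so by the constant rank theorem and Baire's theorem
  every nonempty relatively open subset contains a chart of the maximal rank.
\<close>


section \<open>Derivations and generic points\<close>

text \<open>Three obstacles shape the proof. A derivation of the reals is purely algebraic: unless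
  it is zero it is discontinuous, and nothing makes it compatible with \<open>ln\<close>. Regularity
  of fibres is therefore tested on squared moduli, which are quadratic polynomials in real
  coordinates. The space \<open>V\<close> may have arbitrary coefficients. Declaring finitely many
  numbers constant, namely the coordinates of a real orthonormal basis of \<open>V\<close>, makes
  the remaining derivations commute with the orthogonal projection onto \<open>V\<close>, so a
  generic ambient point projects to a point that is generic inside \<open>V\<close>. Finally, the
  image of a small regular patch of \<open>V\<close> need not be open in the amoeba, because distant
  points of \<open>V\<close> can have nearby images. Regularity of a whole fibre, unlike that of a
  single one of its points, persists over a relatively open part of the amoeba; this is why whole
  fibres are controlled.\<close>

definition unital_subring :: "'a::comm_ring_1 set \<Rightarrow> bool" where
  "unital_subring S \<longleftrightarrow> 1 \<in> S \<and> (\<forall>x\<in>S. \<forall>y\<in>S. x - y \<in> S \<and> x * y \<in> S)"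

text \<open>The values may lie outside \<open>S\<close>: the image of an adjoined algebraic element
  is a quotient, which the subring need not contain.\<close>

definition derivation_on :: "'a::comm_ring_1 set \<Rightarrow> ('a \<Rightarrow> 'a) \<Rightarrow> bool" where
  "derivation_on S D \<longleftrightarrow>
     (\<forall>x\<in>S. \<forall>y\<in>S. D (x + y) = D x + D y \<and> D (x * y) = D x * y + x * D y)"

definition polys_over :: "'a::zero set \<Rightarrow> 'a poly set" where
  "polys_over S = {p. \<forall>i. poly.coeff p i \<in> S}"

lemma unital_subring_1: "unital_subring S \<Longrightarrow> 1 \<in> S"
  and unital_subring_diff: "unital_subring S \<Longrightarrow> x \<in> S \<Longrightarrow> y \<in> S \<Longrightarrow> x - y \<in> S"
  and unital_subring_mult: "unital_subring S \<Longrightarrow> x \<in> S \<Longrightarrow> y \<in> S \<Longrightarrow> x * y \<in> S"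
  by (auto simp: unital_subring_def)

lemma unital_subring_0: "unital_subring S \<Longrightarrow> 0 \<in> S"
  using unital_subring_diff[of S 1 1] by (simp add: unital_subring_1)

lemma unital_subring_uminus: "unital_subring S \<Longrightarrow> x \<in> S \<Longrightarrow> - x \<in> S"
  using unital_subring_diff[of S 0 x] by (simp add: unital_subring_0)

lemma unital_subring_add: "unital_subring S \<Longrightarrow> x \<in> S \<Longrightarrow> y \<in> S \<Longrightarrow> x + y \<in> S"
  using unital_subring_diff[of S x "- y"] by (simp add: unital_subring_uminus)

lemma unital_subring_of_nat: "unital_subring S \<Longrightarrow> of_nat n \<in> S"
  by (induction n) (auto simp: unital_subring_0 unital_subring_1 unital_subring_add)

lemma derivation_on_add:
  "derivation_on S D \<Longrightarrow> x \<in> S \<Longrightarrow> y \<in> S \<Longrightarrow> D (x + y) = D x + D y"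
  and derivation_on_mult:
  "derivation_on S D \<Longrightarrow> x \<in> S \<Longrightarrow> y \<in> S \<Longrightarrow> D (x * y) = D x * y + x * D y"
  by (auto simp: derivation_on_def)

lemma derivation_on_0: "derivation_on S D \<Longrightarrow> 0 \<in> S \<Longrightarrow> D 0 = 0"
  using derivation_on_add[of S D 0 0] by simp

lemma derivation_on_1: "derivation_on S D \<Longrightarrow> 1 \<in> S \<Longrightarrow> D 1 = 0"
  using derivation_on_mult[of S D 1 1] by simp

lemma pCons_in_polys_over: "pCons c p \<in> polys_over S \<longleftrightarrow> c \<in> S \<and> p \<in> polys_over S"
  by (auto simp: polys_over_def coeff_pCons split: nat.splits)

lemma polys_over_0: "unital_subring S \<Longrightarrow> 0 \<in> polys_over S"
  by (simp add: polys_over_def unital_subring_0)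

lemma polys_over_const: "unital_subring S \<Longrightarrow> c \<in> S \<Longrightarrow> [:c:] \<in> polys_over S"
  by (simp add: pCons_in_polys_over polys_over_0)

lemma polys_over_diff:
  "unital_subring S \<Longrightarrow> p \<in> polys_over S \<Longrightarrow> q \<in> polys_over S \<Longrightarrow> p - q \<in> polys_over S"
  by (simp add: polys_over_def unital_subring_diff)

lemma polys_over_add:
  "unital_subring S \<Longrightarrow> p \<in> polys_over S \<Longrightarrow> q \<in> polys_over S \<Longrightarrow> p + q \<in> polys_over S"
  by (simp add: polys_over_def unital_subring_add)

lemma polys_over_smult:
  "unital_subring S \<Longrightarrow> c \<in> S \<Longrightarrow> p \<in> polys_over S \<Longrightarrow> Polynomial.smult c p \<in> polys_over S"
  by (simp add: polys_over_def unital_subring_mult)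

lemma polys_over_monom: "unital_subring S \<Longrightarrow> c \<in> S \<Longrightarrow> Polynomial.monom c n \<in> polys_over S"
  by (simp add: polys_over_def unital_subring_0)

lemma polys_over_mult:
  assumes S: "unital_subring S"
  shows "p \<in> polys_over S \<Longrightarrow> q \<in> polys_over S \<Longrightarrow> p * q \<in> polys_over S"
  by (induction p)
     (auto simp: S pCons_in_polys_over polys_over_0 polys_over_add polys_over_smult unital_subring_0)

lemma polys_over_pderiv:
  assumes S: "unital_subring S"
  shows "p \<in> polys_over S \<Longrightarrow> pderiv p \<in> polys_over S"
  by (auto simp: polys_over_def coeff_pderiv simp del: of_nat_Suc
      intro!: unital_subring_mult[OF S] unital_subring_of_nat[OF S])

text \<open>The value that a derivation extending \<open>D\<close> and sending \<open>a\<close> to \<open>u\<close> must take at \<open>poly p a\<close>.\<close>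

definition deriv_value :: "('a::idom \<Rightarrow> 'a) \<Rightarrow> 'a \<Rightarrow> 'a \<Rightarrow> 'a poly \<Rightarrow> 'a" where
  "deriv_value D a u p = poly (map_poly D p) a + poly (pderiv p) a * u"

context
  fixes S :: "'a::idom set" and D and a u :: 'a
  assumes S: "unital_subring S" and D: "derivation_on S D"
begin

lemma derivation_at_0: "D 0 = 0"
  using derivation_on_0[OF D] unital_subring_0[OF S] by simp

lemma deriv_value_0: "deriv_value D a u 0 = 0"
  by (simp add: deriv_value_def)

lemma deriv_value_pCons:
  "deriv_value D a u (pCons c p) = D c + a * deriv_value D a u p + poly p a * u"
  by (cases "p = 0 \<and> c = 0")
     (auto simp: deriv_value_def map_poly_pCons pderiv_pCons algebra_simps derivation_at_0)

lemma deriv_value_add: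
  "p \<in> polys_over S \<Longrightarrow> q \<in> polys_over S \<Longrightarrow>
   deriv_value D a u (p + q) = deriv_value D a u p + deriv_value D a u q"
  by (induction p q rule: poly_induct2)
     (auto simp: deriv_value_pCons deriv_value_0 pCons_in_polys_over algebra_simps
        derivation_on_add[OF D])

lemma deriv_value_diff:
  assumes "p \<in> polys_over S" "q \<in> polys_over S"
  shows "deriv_value D a u (p - q) = deriv_value D a u p - deriv_value D a u q"
  using deriv_value_add[of "p - q" q] assms by (simp add: polys_over_diff S)

lemma deriv_value_smult:
  "c \<in> S \<Longrightarrow> p \<in> polys_over S \<Longrightarrow>
   deriv_value D a u (Polynomial.smult c p) = D c * poly p a + c * deriv_value D a u p"
  by (induction p)
     (auto simp: deriv_value_pCons deriv_value_0 pCons_in_polys_over algebra_simps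
        derivation_on_mult[OF D])

lemma deriv_value_mult:
  "p \<in> polys_over S \<Longrightarrow> q \<in> polys_over S \<Longrightarrow>
   deriv_value D a u (p * q) = deriv_value D a u p * poly q a + poly p a * deriv_value D a u q"
  by (induction p)
     (auto simp: deriv_value_pCons deriv_value_0 pCons_in_polys_over algebra_simps derivation_at_0
        deriv_value_add deriv_value_smult S polys_over_mult polys_over_smult unital_subring_0)

text \<open>The enlarged ring consists of the values \<open>poly p a\<close>. Since
  \<open>deriv_value\<close> obeys the sum and product rules in \<open>p\<close>, it descends to a
  derivation once it depends on \<open>poly p a\<close> alone, and by additivity this is the
  assumption \<open>wd\<close>.\<close>

lemma derivation_on_adjoin:
  assumes wd: "\<And>p. p \<in> polys_over S \<Longrightarrow> poly p a = 0 \<Longrightarrow> deriv_value D a u p = 0"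
  obtains S' D' where "unital_subring S'" "derivation_on S' D'" "S \<subseteq> S'" "a \<in> S'"
    "\<And>x. x \<in> S \<Longrightarrow> D' x = D x" "D' a = u"
proof -
  define S' where "S' = (\<lambda>p. poly p a) ` polys_over S"
  define D' where "D' x = deriv_value D a u (SOME p. p \<in> polys_over S \<and> poly p a = x)" for x
  have D'_poly: "D' (poly p a) = deriv_value D a u p" if p: "p \<in> polys_over S" for p
  proof -
    define q where "q = (SOME q. q \<in> polys_over S \<and> poly q a = poly p a)"
    have q: "q \<in> polys_over S" "poly q a = poly p a"
      using someI[of "\<lambda>q. q \<in> polys_over S \<and> poly q a = poly p a" p] p
      by (auto simp: q_def)
    have "deriv_value D a u (q - p) = 0"
      using wd[of "q - p"] q p by (simp add: polys_over_diff S)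
    then show ?thesis
      using q p by (simp add: deriv_value_diff D'_def q_def)
  qed
  have "unital_subring S'"
    unfolding unital_subring_def
  proof (intro conjI ballI)
    show "1 \<in> S'"
      unfolding S'_def using polys_over_const[OF S unital_subring_1[OF S]]
      by (intro image_eqI[where x = "[:1:]"]) auto
    fix x y assume "x \<in> S'" "y \<in> S'"
    then obtain p q where *: "p \<in> polys_over S" "x = poly p a" "q \<in> polys_over S" "y = poly q a"
      by (auto simp: S'_def)
    show "x - y \<in> S'"
      unfolding S'_def * using polys_over_diff[OF S *(1,3)]
      by (intro image_eqI[where x = "p - q"]) auto
    show "x * y \<in> S'"
      unfolding S'_def * using polys_over_mult[OF S *(1,3)]
      by (intro image_eqI[where x = "p * q"]) auto
  qed
  moreover have "derivation_on S' D'"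
    unfolding derivation_on_def
  proof (intro ballI)
    fix x y assume "x \<in> S'" "y \<in> S'"
    then obtain p q where *: "p \<in> polys_over S" "x = poly p a" "q \<in> polys_over S" "y = poly q a"
      by (auto simp: S'_def)
    then show "D' (x + y) = D' x + D' y \<and> D' (x * y) = D' x * y + x * D' y"
      using D'_poly[of "p + q"] D'_poly[of "p * q"]
      by (simp add: polys_over_add polys_over_mult S D'_poly deriv_value_add deriv_value_mult)
  qed
  moreover have "x \<in> S'" "D' x = D x" if "x \<in> S" for x
    using polys_over_const[OF S that] D'_poly[of "[:x:]"]
    by (auto simp: S'_def deriv_value_pCons deriv_value_0 intro: image_eqI[where x = "[:x:]"])
  moreover have X: "[:0, 1:] \<in> polys_over S"
    by (simp add: pCons_in_polys_over S unital_subring_0 unital_subring_1 polys_over_0)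
  have "a \<in> S'"
    unfolding S'_def using X by (auto intro: image_eqI[where x = "[:0, 1:]"])
  moreover have "D' a = u"
    using D'_poly[OF X] derivation_on_1[OF D unital_subring_1[OF S]]
    by (simp add: deriv_value_pCons deriv_value_0 derivation_at_0)
  ultimately show thesis
    using that by blast
qed

end

lemma degree_0_root_imp_0:
  assumes "degree p = 0" "poly p a = 0"
  shows "p = 0"
  using assms by (auto elim: degree_eq_zeroE)

text \<open>A transcendental \<open>a\<close> imposes no condition. For an algebraic one, a relation
  \<open>m\<close> of least degree determines \<open>u\<close>, because characteristic zero and
  minimality keep \<open>pderiv m\<close> from vanishing at \<open>a\<close>. All other relations
  reduce to \<open>m\<close> by pseudo-division, which avoids quotients of coefficients that may
  leave \<open>S\<close>.\<close>

lemma ex_deriv_value: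
  fixes S :: "'a::field_char_0 set"
  assumes S: "unital_subring S" and D: "derivation_on S D"
  obtains u where "\<And>p. p \<in> polys_over S \<Longrightarrow> poly p a = 0 \<Longrightarrow> deriv_value D a u p = 0"
proof (cases "\<exists>p. p \<in> polys_over S \<and> p \<noteq> 0 \<and> poly p a = 0")
  case False
  show thesis
    by (rule that[of 0]) (use False in \<open>auto simp: deriv_value_0[OF S D]\<close>)
next
  case True
  define m where
    "m = (ARG_MIN degree p. p \<in> polys_over S \<and> p \<noteq> 0 \<and> poly p a = 0)"
  have m: "m \<in> polys_over S" "m \<noteq> 0" "poly m a = 0"
    using arg_min_natI[of "\<lambda>p. p \<in> polys_over S \<and> p \<noteq> 0 \<and> poly p a = 0" _ degree] True
    by (auto simp: m_def)
  have m_min: "degree m \<le> degree p" if "p \<in> polys_over S" "p \<noteq> 0" "poly p a = 0" for p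
    using arg_min_nat_le[of "\<lambda>p. p \<in> polys_over S \<and> p \<noteq> 0 \<and> poly p a = 0" p degree] that
    by (auto simp: m_def)
  have "degree m > 0"
    using m degree_0_root_imp_0 by blast
  then have "pderiv m \<noteq> 0"
    by (simp add: pderiv_eq_0_iff)
  then have m': "poly (pderiv m) a \<noteq> 0"
    using m_min[of "pderiv m"] \<open>degree m > 0\<close> polys_over_pderiv[OF S m(1)]
    by (auto simp: degree_pderiv)
  define u where "u = - poly (map_poly D m) a / poly (pderiv m) a"
  have dm: "deriv_value D a u m = 0"
    using m' by (simp add: deriv_value_def u_def)
  have "deriv_value D a u p = 0" if "p \<in> polys_over S" "poly p a = 0" for p
    using that
  proof (induction "degree p" arbitrary: p rule: less_induct)
    case less
    show ?case
    proof (cases "p = 0")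
      case True
      then show ?thesis by (simp add: deriv_value_0[OF S D])
    next
      case False
      define r where "r = Polynomial.monom (lead_coeff p) (degree p - degree m)"
      define q where "q = Polynomial.smult (lead_coeff m) p - r * m"
      have lcm: "lead_coeff m \<in> S" "lead_coeff p \<in> S"
        using m less.prems by (auto simp: polys_over_def)
      have r: "r \<in> polys_over S"
        by (simp add: r_def lcm polys_over_monom S)
      have rm: "r * m \<in> polys_over S" "Polynomial.smult (lead_coeff m) p \<in> polys_over S"
        by (simp_all add: r m polys_over_mult S lcm less.prems polys_over_smult)
      have q: "q \<in> polys_over S" "poly q a = 0"
        unfolding q_def using less.prems m by (auto simp: rm polys_over_diff S)
      have "q = 0 \<or> degree q < degree p"
      proof (cases "degree p = 0")
        case True
        then show ?thesis
          using less.prems False degree_0_root_imp_0 by blast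
      next
        case dp: False
        have dr: "degree (r * m) = degree p"
          using m_min[OF less.prems(1) False less.prems(2)] m False
          by (simp add: r_def degree_mult_eq degree_monom_eq)
        have "poly.coeff q (degree p) = 0"
          using dr lead_coeff_mult[of r m] False
          by (simp add: q_def) (simp add: r_def degree_monom_eq)
        moreover have "degree q \<le> degree p"
          unfolding q_def using dr by (intro degree_diff_le) auto
        ultimately show ?thesis
          using dp by (metis le_neq_implies_less leading_coeff_0_iff)
      qed
      then have "deriv_value D a u q = 0"
        using less.hyps[of q] q by (auto simp: deriv_value_0[OF S D])
      then have "lead_coeff m * deriv_value D a u p = 0"
        unfolding q_def
        by (simp add: deriv_value_diff[OF S D] rm deriv_value_smult[OF S D] lcm less.prems
            deriv_value_mult[OF S D] r m dm)
      then show ?thesis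
        using m by simp
    qed
  qed
  then show thesis
    by (rule that)
qed

text \<open>Zorn's lemma for derivations on subrings ordered by extension. Encoding a derivation as
  its graph over the subring turns extension into inclusion and upper bounds of chains into unions.
  A maximal domain is everything, since any further element could be adjoined.\<close>

lemma derivation_on_extend_UNIV:
  fixes S :: "'a::field_char_0 set"
  assumes S: "unital_subring S" and D: "derivation_on S D"
  obtains D' where "derivation_on UNIV D'" "\<And>x. x \<in> S \<Longrightarrow> D' x = D x"
proof -
  define graph where "graph = (\<lambda>S (D::'a \<Rightarrow> 'a). (\<lambda>x. (x, D x)) ` S)"
  define good where "good = {g. \<exists>S' D'. g = graph S' D' \<and> unital_subring S' \<and> derivation_on S' D' \<and>
    graph S D \<subseteq> g}"
  have graph: "(x, y) \<in> graph S D \<longleftrightarrow> x \<in> S \<and> y = D x" for x y S D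
    by (auto simp: graph_def)
  have "\<exists>M\<in>good. \<forall>X\<in>good. M \<subseteq> X \<longrightarrow> X = M"
  proof (rule subset_Zorn_nonempty)
    show "good \<noteq> {}"
      using S D by (auto simp: good_def)
    fix C assume C: "C \<noteq> {}" "subset.chain good C"
    define S' where "S' = fst ` \<Union>C"
    define D' where "D' x = (SOME y. (x, y) \<in> \<Union>C)" for x
    \<comment> \<open>Two members of a chain are comparable, so finitely many elements of the union
      can be handled inside a single member.\<close>
    have common: "\<exists>T E. graph T E \<in> C \<and> unital_subring T \<and> derivation_on T E \<and> g \<subseteq> graph T E \<and> h \<subseteq> graph T E"
      if gh: "g \<in> C" "h \<in> C" for g h
    proof -
      have "g \<union> h \<in> C"
        using C(2) gh unfolding subset_chain_def by (metis sup.absorb1 sup.absorb2)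
      then have "g \<union> h \<in> good"
        using C(2) by (auto simp: subset_chain_def)
      then obtain T E where "g \<union> h = graph T E" "unital_subring T" "derivation_on T E"
        unfolding good_def by blast
      with \<open>g \<union> h \<in> C\<close> show ?thesis
        by (intro exI[of _ T] exI[of _ E]) auto
    qed
    have D': "D' x = E x" "x \<in> S'" if g: "graph T E \<in> C" "x \<in> T" for x T E
    proof -
      have *: "(x, E x) \<in> \<Union>C"
        using g by (intro UnionI[of "graph T E"]) (auto simp: graph)
      then show "x \<in> S'"
        unfolding S'_def by (metis fst_conv imageI)
      have "(x, D' x) \<in> \<Union>C"
        unfolding D'_def by (rule someI[of _ "E x"]) (fact *)
      then obtain h where "h \<in> C" "(x, D' x) \<in> h"
        by blast
      then obtain T' E' where "graph T E \<subseteq> graph T' E'" "h \<subseteq> graph T' E'"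
        using common[OF g(1), of h] by blast
      then have "(x, E x) \<in> graph T' E'" "(x, D' x) \<in> graph T' E'"
        using \<open>(x, D' x) \<in> h\<close> g graph[of x "E x" T E] by auto
      then show "D' x = E x"
        by (simp add: graph)
    qed
    have two: "\<exists>T E. graph T E \<in> C \<and> unital_subring T \<and> derivation_on T E \<and> x \<in> T \<and> y \<in> T"
      if xy: "x \<in> S'" "y \<in> S'" for x y
    proof -
      obtain g x' where "g \<in> C" "(x, x') \<in> g"
        using xy(1) by (auto simp: S'_def)
      moreover obtain h y' where "h \<in> C" "(y, y') \<in> h"
        using xy(2) by (auto simp: S'_def)
      ultimately have gh: "g \<in> C" "h \<in> C" "(x, x') \<in> g" "(y, y') \<in> h"
        by auto
      with common[OF gh(1,2)] obtain T E where
        TE: "graph T E \<in> C" "unital_subring T" "derivation_on T E" "g \<subseteq> graph T E" "h \<subseteq> graph T E"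
        by blast
      then have "(x, x') \<in> graph T E" "(y, y') \<in> graph T E"
        using gh by blast+
      then show ?thesis
        using TE by (intro exI[of _ T] exI[of _ E]) (auto simp: graph)
    qed
    obtain g where g: "g \<in> C"
      using C by blast
    then obtain T E where TE: "graph T E \<in> C" "unital_subring T" "graph S D \<subseteq> graph T E"
      using C(2) by (auto simp: subset_chain_def good_def)
    have "1 \<in> S'"
      using D'(2)[OF TE(1) unital_subring_1[OF TE(2)]] .
    have closed: "x - y \<in> S' \<and> x * y \<in> S'" "D' (x + y) = D' x + D' y \<and> D' (x * y) = D' x * y + x * D' y"
      if xy: "x \<in> S'" "y \<in> S'" for x y
    proof -
      obtain T E where TE: "graph T E \<in> C" "unital_subring T" "derivation_on T E" "x \<in> T" "y \<in> T"
        using two[OF xy] by blast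
      then show "x - y \<in> S' \<and> x * y \<in> S'"
        "D' (x + y) = D' x + D' y \<and> D' (x * y) = D' x * y + x * D' y"
        using D'[OF TE(1)] by (auto simp: unital_subring_diff unital_subring_mult unital_subring_add derivation_on_add
            derivation_on_mult)
    qed
    have "unital_subring S'" "derivation_on S' D'"
      using \<open>1 \<in> S'\<close> closed by (auto simp: unital_subring_def derivation_on_def)
    moreover have "\<Union>C = graph S' D'"
    proof (safe)
      fix x y h assume h: "(x, y) \<in> h" "h \<in> C"
      then obtain T E where "graph T E \<in> C" "h \<subseteq> graph T E"
        using common[of h h] by blast
      then show "(x, y) \<in> graph S' D'"
        using h D'[of T E x] by (auto simp: graph)
    next
      fix x y assume "(x, y) \<in> graph S' D'"
      then have xy: "x \<in> S'" "y = D' x"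
        by (auto simp: graph)
      then obtain T E where "graph T E \<in> C" "x \<in> T"
        using two[of x x] by blast
      then show "(x, y) \<in> \<Union>C"
        using D'[of T E x] xy by (intro UnionI[of "graph T E"]) (auto simp: graph)
    qed
    moreover have "graph S D \<subseteq> \<Union>C"
      using TE by blast
    ultimately show "\<Union>C \<in> good"
      by (auto simp: good_def)
  qed
  then obtain M where M: "M \<in> good" "\<forall>X\<in>good. M \<subseteq> X \<longrightarrow> X = M" ..
  then obtain T E where TE: "M = graph T E" "unital_subring T" "derivation_on T E" "graph S D \<subseteq> M"
    unfolding good_def by blast
  have max: "graph T' E' = M" if "unital_subring T'" "derivation_on T' E'" "M \<subseteq> graph T' E'" for T' E'
  proof -
    have "graph T' E' \<in> good"
      unfolding good_def using that TE(4) by blast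
    then show ?thesis
      using M(2) that(3) by blast
  qed
  have "a \<in> T" for a
  proof -
    obtain u where u: "\<And>p. p \<in> polys_over T \<Longrightarrow> poly p a = 0 \<Longrightarrow> deriv_value E a u p = 0"
      using ex_deriv_value[OF TE(2,3), of a] by metis
    obtain T' E' where T': "unital_subring T'" "derivation_on T' E'" "T \<subseteq> T'" "a \<in> T'"
      "\<And>x. x \<in> T \<Longrightarrow> E' x = E x"
      using derivation_on_adjoin[OF TE(2,3) u] by metis
    have "graph T E \<subseteq> graph T' E'"
      using T' by (auto simp: graph_def)
    then have "graph T' E' = graph T E"
      using max[OF T'(1,2)] TE(1) by simp
    then show ?thesis
      using T'(4) TE(1) graph[of a "E' a" T E] graph[of a "E' a" T' E'] by simp
  qed
  then have "T = UNIV"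
    by blast
  moreover have "E x = D x" if "x \<in> S" for x
    using TE(1,4) that graph[of x "D x" T E] graph[of x "D x" S D] by auto
  ultimately show thesis
    using that[of E] TE(3) by simp
qed

text \<open>No relation constrains the image of a transcendental element, so the zero derivation
  extends with the value 1 there.\<close>

lemma derivation_transcendental:
  fixes S :: "'a::field_char_0 set"
  assumes S: "unital_subring S" and a: "\<And>p. p \<in> polys_over S \<Longrightarrow> poly p a = 0 \<Longrightarrow> p = 0"
  obtains D where "derivation_on UNIV D" "\<And>x. x \<in> S \<Longrightarrow> D x = 0" "D a = 1"
proof -
  have D: "derivation_on S (\<lambda>_. 0)"
    by (simp add: derivation_on_def)
  have "deriv_value (\<lambda>_. 0) a 1 p = 0" if "p \<in> polys_over S" "poly p a = 0" for p
    using a[OF that] by (simp add: deriv_value_0[OF S D])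
  then obtain S' D' where S': "unital_subring S'" "derivation_on S' D'" "S \<subseteq> S'" "a \<in> S'"
    "\<And>x. x \<in> S \<Longrightarrow> D' x = 0" "D' a = 1"
    using derivation_on_adjoin[OF S D, of a 1] by metis
  obtain D'' where "derivation_on UNIV D''" "\<And>x. x \<in> S' \<Longrightarrow> D'' x = D' x"
    using derivation_on_extend_UNIV[OF S'(1,2)] by blast
  then show thesis
    using that[of D''] S' by (metis subsetD)
qed

section \<open>Points that are transcendental over countably many constants\<close>

lemma countable_subring_hull:
  fixes K :: "'a::comm_ring_1 set"
  assumes "countable K"
  obtains S where "countable S" "unital_subring S" "K \<subseteq> S"
proof -
  define step where "step T = T \<union> (\<lambda>(x, y). x - y) ` (T \<times> T) \<union> (\<lambda>(x, y). x * y) ` (T \<times> T)"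
    for T :: "'a set"
  define A where "A n = (step ^^ n) (insert 1 K)" for n
  have A_Suc: "A (Suc n) = step (A n)" for n
    by (simp add: A_def)
  have "countable (A n)" for n
    by (induction n) (auto simp: A_def step_def assms)
  moreover have mono: "A m \<subseteq> A n" if "m \<le> n" for m n
    using that by (rule lift_Suc_mono_le[rotated]) (auto simp: A_Suc step_def)
  have "unital_subring (\<Union>n. A n)"
    unfolding unital_subring_def
  proof (intro conjI ballI)
    show "1 \<in> (\<Union>n. A n)"
      by (rule UN_I[of 0]) (auto simp: A_def)
    fix x y assume "x \<in> (\<Union>n. A n)" "y \<in> (\<Union>n. A n)"
    then obtain m n where "x \<in> A m" "y \<in> A n"
      by blast
    then have "x \<in> A (max m n)" "y \<in> A (max m n)"
      using mono[of m "max m n"] mono[of n "max m n"] by auto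
    then have "x - y \<in> A (Suc (max m n))" "x * y \<in> A (Suc (max m n))"
      by (auto simp: A_Suc step_def)
    then show "x - y \<in> (\<Union>n. A n)" "x * y \<in> (\<Union>n. A n)"
      by blast+
  qed
  moreover have "K \<subseteq> (\<Union>n. A n)"
    by (rule subset_trans[OF _ UN_upper[of 0]]) (auto simp: A_def)
  ultimately show thesis
    using that[of "\<Union>n. A n"] by blast
qed

lemma countable_polys_over:
  assumes "countable S"
  shows "countable (polys_over S)"
proof -
  have "coeffs ` polys_over S \<subseteq> lists S"
    by (auto simp: polys_over_def coeffs_def)
  then have "countable (coeffs ` polys_over S)"
    using assms by (meson countable_lists countable_subset)
  then show ?thesis
    by (rule countable_image_inj_on) (auto intro: inj_onI simp: coeffs_eq_iff)
qed

text \<open>Only countably many reals are algebraic over a countable ring, so an interval always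
  contains a transcendental one.\<close>

lemma ex_derivation_interval:
  fixes a b :: real
  assumes K: "countable K" and "a < b"
  obtains x D where "a < x" "x < b" "derivation_on UNIV D" "\<And>y. y \<in> K \<Longrightarrow> D y = 0" "D x = 1"
proof -
  obtain S where S: "countable S" "unital_subring S" "K \<subseteq> S"
    using countable_subring_hull[OF K] .
  define R where "R = (\<Union>p\<in>polys_over S - {0}. {x. poly p x = 0})"
  have "countable R"
    unfolding R_def
    by (intro countable_UN countable_Diff countable_polys_over S countable_finite poly_roots_finite)
       auto
  then obtain x where x: "x \<in> {a<..<b} - R"
    using uncountable_minus_countable[of "{a<..<b}" R] \<open>a < b\<close>
    by (metis countable_empty ex_in_conv uncountable_open_interval)
  then have "p = 0" if "p \<in> polys_over S" "poly p x = 0" for p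
    using that by (auto simp: R_def)
  then obtain D where "derivation_on UNIV D" "\<And>x. x \<in> S \<Longrightarrow> D x = 0" "D x = 1"
    using derivation_transcendental[OF S(2), of x] by metis
  then show thesis
    using that[of x D] x S(3) by auto
qed

text \<open>The action on coordinates is additive but in general not linear, as scaling follows the
  Leibniz rule. Invariance of a subspace under it is thus a genuine condition.\<close>

definition dmap :: "(real \<Rightarrow> real) \<Rightarrow> 'a::euclidean_space \<Rightarrow> 'a" where
  "dmap D v = (\<Sum>b\<in>Basis. D (v \<bullet> b) *\<^sub>R b)"

lemma derivation_comb:
  assumes "derivation_on UNIV D" "derivation_on UNIV E"
  shows "derivation_on UNIV (\<lambda>x. D x + c * E x)"
  using assms by (simp add: derivation_on_def algebra_simps)

lemma derivation_sum:
  assumes "derivation_on UNIV D"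
  shows "D (\<Sum>i\<in>A. f i) = (\<Sum>i\<in>A. D (f i))"
  using assms derivation_on_0[OF assms]
  by (induction A rule: infinite_finite_induct) (auto simp: derivation_on_add)

lemma dmap_inner_Basis: "b \<in> Basis \<Longrightarrow> dmap D v \<bullet> b = D (v \<bullet> b)"
  by (simp add: dmap_def inner_sum_left inner_Basis if_distrib cong: if_cong)

lemma dmap_add: "derivation_on UNIV D \<Longrightarrow> dmap D (v + w) = dmap D v + dmap D w"
  by (rule euclidean_eqI) (simp add: dmap_inner_Basis inner_add_left derivation_on_add)

lemma dmap_0: "derivation_on UNIV D \<Longrightarrow> dmap D 0 = 0"
  by (rule euclidean_eqI) (simp add: dmap_inner_Basis derivation_on_0)

lemma dmap_sum: "derivation_on UNIV D \<Longrightarrow> dmap D (\<Sum>i\<in>A. f i) = (\<Sum>i\<in>A. dmap D (f i))"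
  by (induction A rule: infinite_finite_induct) (auto simp: dmap_add dmap_0)

lemma dmap_scaleR:
  "derivation_on UNIV D \<Longrightarrow> dmap D (c *\<^sub>R v) = D c *\<^sub>R v + c *\<^sub>R dmap D v"
  by (rule euclidean_eqI) (simp add: dmap_inner_Basis inner_add_left derivation_on_mult)

lemma dmap_inner:
  assumes "derivation_on UNIV D"
  shows "D (v \<bullet> w) = dmap D v \<bullet> w + v \<bullet> dmap D w"
proof -
  have "D (v \<bullet> w) = (\<Sum>b\<in>Basis. D ((v \<bullet> b) * (w \<bullet> b)))"
    by (subst euclidean_inner) (simp add: derivation_sum[OF assms])
  also have "\<dots> = (\<Sum>b\<in>Basis. (dmap D v \<bullet> b) * (w \<bullet> b)) + (\<Sum>b\<in>Basis. (v \<bullet> b) * (dmap D w \<bullet> b))"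
    by (simp add: derivation_on_mult[OF assms] dmap_inner_Basis sum.distrib)
  also have "\<dots> = dmap D v \<bullet> w + v \<bullet> dmap D w"
    by (simp add: euclidean_inner[symmetric])
  finally show ?thesis .
qed

text \<open>Each new coordinate is transcendental over the constants and the earlier coordinates, so
  some derivation \<open>E\<close> moves it alone. Adding a multiple of \<open>E\<close> corrects
  the value there without disturbing the others.\<close>

lemma ex_generic_coords:
  fixes a b :: "'i \<Rightarrow> real"
  assumes "finite S" "countable K" "\<And>i. i \<in> S \<Longrightarrow> a i < b i"
  shows "\<exists>x. (\<forall>i\<in>S. a i < x i \<and> x i < b i) \<and>
    (\<forall>w. \<exists>D. derivation_on UNIV D \<and> (\<forall>y\<in>K. D y = 0) \<and> (\<forall>i\<in>S. D (x i) = w i))"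
  using assms
proof (induction S rule: finite_induct)
  case empty
  have "derivation_on UNIV (\<lambda>_::real. 0::real)"
    by (simp add: derivation_on_def)
  then show ?case
    by (intro exI conjI allI) auto
next
  case (insert j S)
  have "\<exists>x. (\<forall>i\<in>S. a i < x i \<and> x i < b i) \<and>
    (\<forall>w. \<exists>D. derivation_on UNIV D \<and> (\<forall>y\<in>K. D y = 0) \<and> (\<forall>i\<in>S. D (x i) = w i))"
    using insert.IH insert.prems by simp
  then obtain x where x: "\<And>i. i \<in> S \<Longrightarrow> a i < x i \<and> x i < b i"
    and xD: "\<And>w. \<exists>D. derivation_on UNIV D \<and> (\<forall>y\<in>K. D y = 0) \<and> (\<forall>i\<in>S. D (x i) = w i)"
    by blast
  have "countable (K \<union> x ` S)"
    using insert by (simp add: countable_finite)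
  then obtain t E where t: "a j < t" "t < b j" and E: "derivation_on UNIV E"
    "\<And>y. y \<in> K \<union> x ` S \<Longrightarrow> E y = 0" "E t = 1"
    using ex_derivation_interval[of "K \<union> x ` S" "a j" "b j"] insert.prems(2)[of j] by (metis insertI1)
  have "\<exists>D. derivation_on UNIV D \<and> (\<forall>y\<in>K. D y = 0) \<and> (\<forall>i\<in>insert j S. D ((x(j := t)) i) = w i)"
    for w
  proof -
    obtain D where D: "derivation_on UNIV D" "\<forall>y\<in>K. D y = 0" "\<forall>i\<in>S. D (x i) = w i"
      using xD[of w] by metis
    have "D y + (w j - D t) * E y = 0" if "y \<in> K" for y
      using D E(2)[of y] that by simp
    moreover have "D ((x(j := t)) i) + (w j - D t) * E ((x(j := t)) i) = w i" if "i \<in> insert j S" for i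
      using that D(3) E(2)[of "x i"] E(3) insert.hyps by (cases "i = j") auto
    ultimately show ?thesis
      using derivation_comb[OF D(1) E(1), of "w j - D t"]
      by (intro exI[of _ "\<lambda>y. D y + (w j - D t) * E y"]) simp
  qed
  moreover have "\<forall>i\<in>insert j S. a i < (x(j := t)) i \<and> (x(j := t)) i < b i"
    using x t insert.hyps by auto
  ultimately show ?case
    by (intro exI[of _ "x(j := t)"] conjI allI)
qed

text \<open>The second conclusion forces the coordinates of \<open>z\<close> to be algebraically
  independent over the constants; it is stated in the form in which it is used, as freedom to move
  \<open>z\<close> in any direction.\<close>

lemma ex_generic_point:
  fixes N :: "'a::euclidean_space set"
  assumes "open N" "N \<noteq> {}" "countable K"
  obtains z where "z \<in> N"
    "\<And>w. \<exists>D. derivation_on UNIV D \<and> (\<forall>y\<in>K. D y = 0) \<and> dmap D z = w"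
proof -
  obtain z0 where "z0 \<in> N"
    using assms by blast
  obtain a b where ab: "z0 \<in> box a b" "box a b \<subseteq> N"
    using open_contains_box[OF assms(1) \<open>z0 \<in> N\<close>] by metis
  have "a \<bullet> i < b \<bullet> i" if "i \<in> Basis" for i
    using ab(1) that by (auto simp: mem_box intro: less_trans)
  then obtain x where x: "\<forall>i\<in>Basis. a \<bullet> i < x i \<and> x i < b \<bullet> i"
    and xD: "\<And>w. \<exists>D. derivation_on UNIV D \<and> (\<forall>y\<in>K. D y = 0) \<and> (\<forall>i\<in>(Basis::'a set). D (x i) = w i)"
    using ex_generic_coords[of "Basis :: 'a set" K "\<lambda>i. a \<bullet> i" "\<lambda>i. b \<bullet> i"] assms(3)
    by (metis finite_Basis)
  define z where "z = (\<Sum>i\<in>Basis. x i *\<^sub>R i :: 'a)"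
  have z: "z \<bullet> i = x i" if "i \<in> Basis" for i
    using that by (simp add: z_def)
  have zD: "\<exists>D. derivation_on UNIV D \<and> (\<forall>y\<in>K. D y = 0) \<and> dmap D z = w" for w
  proof -
    obtain D where D: "derivation_on UNIV D" "\<forall>y\<in>K. D y = 0" "\<forall>i\<in>(Basis::'a set). D (x i) = w \<bullet> i"
      using xD[of "\<lambda>i. w \<bullet> i"] by metis
    have "dmap D z = w"
      by (rule euclidean_eqI) (simp add: dmap_inner_Basis z D)
    then show ?thesis
      using D by metis
  qed
  have "z \<in> box a b"
    using x z by (simp add: mem_box)
  then show thesis
    using ab(2) zD by (intro that[of z]) auto
qed

section \<open>Generic hyperplane sections\<close>

lemma dim_hyperplane_section_le:
  fixes S :: "'a::euclidean_space set"
  assumes S: "subspace S" and v: "v \<in> S" "v \<bullet> z \<noteq> 0"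
  shows "dim (S \<inter> {x. x \<bullet> z = 0}) < dim S"
proof (rule dim_psubset)
  have "subspace {x. x \<bullet> z = 0}"
    by (simp add: subspace_def inner_add_left)
  then have "span (S \<inter> {x. x \<bullet> z = 0}) = S \<inter> {x. x \<bullet> z = 0}"
    by (simp add: span_eq_iff subspace_inter S)
  moreover have "span S = S"
    by (simp add: span_eq_iff S)
  ultimately show "span (S \<inter> {x. x \<bullet> z = 0}) \<subset> span S"
    using v by (auto simp only:)
qed

lemma dim_hyperplane_section_ge:
  fixes S :: "'a::euclidean_space set"
  assumes S: "subspace S"
  shows "dim S - 1 \<le> dim (S \<inter> {x. x \<bullet> z = 0})"
proof (cases "\<exists>v\<in>S. v \<bullet> z \<noteq> 0")
  case True
  then obtain v where v: "v \<in> S" "v \<bullet> z \<noteq> 0" by blast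
  have "S \<subseteq> span (insert v (S \<inter> {x. x \<bullet> z = 0}))"
  proof
    fix x assume x: "x \<in> S"
    define c where "c = (x \<bullet> z) / (v \<bullet> z)"
    have "x - c *\<^sub>R v \<in> S \<inter> {x. x \<bullet> z = 0}"
      using v x by (simp add: c_def inner_diff_left subspace_diff subspace_scale S)
    then have "x - c *\<^sub>R v \<in> span (S \<inter> {x. x \<bullet> z = 0})"
      by (rule span_base)
    then show "x \<in> span (insert v (S \<inter> {x. x \<bullet> z = 0}))"
      unfolding span_insert by blast
  qed
  then have "dim S \<le> dim (insert v (S \<inter> {x. x \<bullet> z = 0}))"
    by (metis dim_span dim_subset)
  also have "\<dots> \<le> Suc (dim (S \<inter> {x. x \<bullet> z = 0}))"
    by (simp add: dim_insert)
  finally show ?thesis by simp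
next
  case False
  then have "S \<inter> {x. x \<bullet> z = 0} = S" by auto
  then show ?thesis by simp
qed

lemma span_UN_subspaces:
  fixes A :: "'i \<Rightarrow> 'a::real_vector set"
  assumes T: "finite T" and A: "\<And>i. i \<in> T \<Longrightarrow> subspace (A i)"
  shows "span (\<Union>i\<in>T. A i) = {v. \<exists>u. (\<forall>i\<in>T. u i \<in> A i) \<and> v = (\<Sum>i\<in>T. u i)}" (is "_ = ?R")
proof
  show "?R \<subseteq> span (\<Union>i\<in>T. A i)"
    by (auto intro!: span_sum intro: span_base)
  have "subspace ?R"
  proof (rule subspaceI)
    show "0 \<in> ?R"
      using A by (auto intro!: exI[of _ "\<lambda>_. 0"] simp: subspace_0)
    fix x y assume "x \<in> ?R" "y \<in> ?R"
    then obtain u v where "\<forall>i\<in>T. u i \<in> A i" "x = (\<Sum>i\<in>T. u i)" "\<forall>i\<in>T. v i \<in> A i" "y = (\<Sum>i\<in>T. v i)"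
      by auto
    then show "x + y \<in> ?R"
      using A by (auto intro!: exI[of _ "\<lambda>i. u i + v i"] simp: subspace_add sum.distrib)
  next
    fix c x assume "x \<in> ?R"
    then obtain u where "\<forall>i\<in>T. u i \<in> A i" "x = (\<Sum>i\<in>T. u i)"
      by auto
    then show "c *\<^sub>R x \<in> ?R"
      using A by (auto intro!: exI[of _ "\<lambda>i. c *\<^sub>R u i"] simp: subspace_scale scaleR_sum_right)
  qed
  moreover have "(\<Union>i\<in>T. A i) \<subseteq> ?R"
  proof safe
    fix i x assume "i \<in> T" "x \<in> A i"
    then show "\<exists>u. (\<forall>i\<in>T. u i \<in> A i) \<and> x = (\<Sum>i\<in>T. u i)"
      using A T by (intro exI[of _ "\<lambda>j. if j = i then x else 0"]) (auto simp: subspace_0)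
  qed
  ultimately show "span (\<Union>i\<in>T. A i) \<subseteq> ?R"
    by (rule span_minimal[rotated])
qed

lemma dim_span_UN_le:
  fixes A :: "'i \<Rightarrow> 'a::euclidean_space set"
  assumes "finite T"
  shows "dim (span (\<Union>i\<in>T. A i)) \<le> (\<Sum>i\<in>T. dim (A i))"
proof -
  have "\<exists>B. A i \<subseteq> span B \<and> finite B \<and> card B = dim (A i)" for i
    by (metis basis_exists finiteI_independent)
  then obtain B where B: "\<And>i. A i \<subseteq> span (B i)" "\<And>i. finite (B i)" "\<And>i. card (B i) = dim (A i)"
    by metis
  have "span (\<Union>i\<in>T. A i) \<subseteq> span (\<Union>i\<in>T. B i)"
  proof (rule span_minimal)
    show "(\<Union>i\<in>T. A i) \<subseteq> span (\<Union>i\<in>T. B i)"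
      using B(1) span_mono[of "B _" "\<Union>i\<in>T. B i"] by blast
  qed simp
  then have "dim (span (\<Union>i\<in>T. A i)) \<le> card (\<Union>i\<in>T. B i)"
    using B(2) assms by (intro dim_le_card) auto
  also have "\<dots> \<le> (\<Sum>i\<in>T. card (B i))"
    by (rule card_UN_le) fact
  finally show ?thesis
    by (simp add: B(3))
qed

text \<open>Directness of the sum is phrased through families \<open>u\<close>, so that its failure
  hands over a concrete relation between vectors.\<close>

lemma dim_span_UN_independent:
  fixes A :: "'i \<Rightarrow> 'a::euclidean_space set"
  assumes "finite T" "\<And>i. i \<in> T \<Longrightarrow> subspace (A i)"
    "\<And>u. (\<forall>i\<in>T. u i \<in> A i) \<Longrightarrow> (\<Sum>i\<in>T. u i) = 0 \<Longrightarrow> \<forall>i\<in>T. u i = 0"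
  shows "dim (span (\<Union>i\<in>T. A i)) = (\<Sum>i\<in>T. dim (A i))"
  using assms
proof (induction T rule: finite_induct)
  case empty
  then show ?case by simp
next
  case (insert j T)
  let ?S = "span (\<Union>i\<in>T. A i)"
  have IH: "dim ?S = (\<Sum>i\<in>T. dim (A i))"
  proof (rule insert.IH)
    fix u assume u: "\<forall>i\<in>T. u i \<in> A i" "(\<Sum>i\<in>T. u i) = 0"
    let ?u = "u(j := 0)"
    have "(\<Sum>i\<in>insert j T. ?u i) = (\<Sum>i\<in>T. ?u i)"
      using insert.hyps by simp
    also have "\<dots> = (\<Sum>i\<in>T. u i)"
      using insert.hyps by (intro sum.cong) auto
    finally have "(\<Sum>i\<in>insert j T. ?u i) = 0"
      using u by simp
    moreover have "\<forall>i\<in>insert j T. ?u i \<in> A i"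
      using u insert.prems(1) by (auto simp: subspace_0)
    ultimately have "\<forall>i\<in>insert j T. ?u i = 0"
      by (rule insert.prems(2)[rotated])
    then show "\<forall>i\<in>T. u i = 0"
      using insert.hyps by (auto split: if_splits)
  qed (use insert.prems in auto)
  have Aj: "subspace (A j)"
    using insert.prems by simp
  have "A j \<inter> ?S \<subseteq> {0}"
  proof
    fix v assume v: "v \<in> A j \<inter> ?S"
    then obtain u where u: "\<forall>i\<in>T. u i \<in> A i" "v = (\<Sum>i\<in>T. u i)"
      using span_UN_subspaces[of T A] insert.hyps insert.prems by auto
    let ?u = "u(j := - v)"
    have "(\<Sum>i\<in>insert j T. ?u i) = - v + (\<Sum>i\<in>T. ?u i)"
      using insert.hyps by simp
    also have "(\<Sum>i\<in>T. ?u i) = v"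
      unfolding u(2) using insert.hyps by (intro sum.cong) auto
    finally have "(\<Sum>i\<in>insert j T. ?u i) = 0"
      by simp
    moreover have "\<forall>i\<in>insert j T. ?u i \<in> A i"
      using u v by (auto intro: subspace_neg[OF Aj])
    ultimately have "\<forall>i\<in>insert j T. ?u i = 0"
      by (rule insert.prems(2)[rotated])
    then show "v \<in> {0}"
      by simp
  qed
  then have int: "dim (A j \<inter> ?S) = 0"
    by (simp add: dim_eq_0)
  have "span (\<Union>i\<in>insert j T. A i) = {x + y |x y. x \<in> A j \<and> y \<in> ?S}"
    using span_Un[of "A j" "\<Union>i\<in>T. A i"] Aj by (auto simp: span_eq_iff[THEN iffD2, OF Aj])
  then show ?case
    using dim_sums_Int[OF Aj subspace_span, of "\<Union>i\<in>T. A i"] int IH insert.hyps by simp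
qed

text \<open>The setting of Lovasz's theorem. \<open>generic\<close> tests \<open>dmap D z\<close>
  only against the spaces \<open>G i\<close>, because in the application \<open>z\<close> is a
  projected point and moves only inside \<open>V\<close>. \<open>stable\<close> says that the flats
  behave as if defined over the constants of \<open>\<Delta>\<close>.\<close>

locale generic_hyperplane =
  fixes G :: "'i::finite \<Rightarrow> 'a::euclidean_space set"
    and z :: 'a
    and \<Delta> :: "(real \<Rightarrow> real) set"
  assumes subspace_G: "subspace (G i)"
    and derivation: "D \<in> \<Delta> \<Longrightarrow> derivation_on UNIV D"
    and stable: "D \<in> \<Delta> \<Longrightarrow> v \<in> G i \<Longrightarrow> dmap D v \<in> G i"
    and generic: "\<exists>D\<in>\<Delta>. \<forall>i. \<forall>v\<in>G i. v \<bullet> dmap D z = v \<bullet> w"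
    and nondegenerate: "\<exists>v\<in>G i. v \<bullet> z \<noteq> 0"
begin

definition F :: "'i set \<Rightarrow> 'a set" where "F B = span (\<Union>i\<in>B. G i)"

definition H :: "'a set" where "H = {v. v \<bullet> z = 0}"

definition L :: "'i set \<Rightarrow> 'a set" where "L B = span (\<Union>i\<in>B. G i \<inter> H)"

text \<open>The reverse inclusion always holds, so tightness means that the section of the flat is
  spanned by the sections of its generators.\<close>

definition tight :: "'i set \<Rightarrow> bool" where "tight B \<longleftrightarrow> F B \<inter> H \<subseteq> L B"

lemma subspace_F: "subspace (F B)" and subspace_L: "subspace (L B)" and subspace_H: "subspace H"
  by (simp_all add: F_def L_def H_def subspace_def inner_add_left span_zero span_add span_scale)

lemma L_mono: "B \<subseteq> C \<Longrightarrow> L B \<subseteq> L C"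
  unfolding L_def by (intro span_mono) auto

lemma dmap_F:
  assumes D: "D \<in> \<Delta>" and v: "v \<in> F B"
  shows "dmap D v \<in> F B"
  using v unfolding F_def
proof (induction rule: span_induct_alt)
  case base
  then show ?case
    by (simp add: dmap_0 derivation D span_zero)
next
  case (step c x y)
  then have "x \<in> span (\<Union>i\<in>B. G i)" "dmap D x \<in> span (\<Union>i\<in>B. G i)"
    using stable[OF D] by (auto intro: span_base)
  then show ?case
    using step by (simp add: dmap_add dmap_scaleR derivation D span_add span_scale)
qed

lemma ex_derivation_F: "\<exists>D\<in>\<Delta>. \<forall>v\<in>F B. v \<bullet> dmap D z = v \<bullet> w"
proof -
  obtain D where D: "D \<in> \<Delta>" "\<And>i v. v \<in> G i \<Longrightarrow> v \<bullet> dmap D z = v \<bullet> w"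
    using generic by metis
  have "v \<bullet> dmap D z = v \<bullet> w" if "v \<in> F B" for v
    using that unfolding F_def
    by (induction rule: span_induct_alt) (auto simp: inner_add_left D(2))
  then show ?thesis
    using D(1) by blast
qed

text \<open>A minimal linear relation \<open>\<Sum>B\<in>T. u B = 0\<close> is differentiated along derivations that move
  \<open>z\<close> in a direction \<open>w\<close> seen only by \<open>u s\<close> and \<open>u t\<close>. As the flats are stable, \<open>dmap D (u B)\<close> stays
  in \<open>F B\<close> and lies in \<open>H\<close> unless \<open>B\<close> is \<open>s\<close> or \<open>t\<close>; hence \<open>F s\<close> and \<open>F t\<close> agree modulo
  \<open>L (\<Union>T)\<close> up to their sections with \<open>H\<close>.\<close>

lemma ex_tight_Union:
  assumes tight: "\<And>B. B \<in> P \<Longrightarrow> tight B" and ne: "{} \<notin> P"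
    and u: "\<And>B. B \<in> P \<Longrightarrow> u B \<in> F B \<inter> H" "(\<Sum>B\<in>P. u B) = 0" "\<exists>B\<in>P. u B \<noteq> 0"
  obtains T where "T \<subseteq> P" "2 \<le> card T" "tight (\<Union>T)"
proof -
  define R where "R T u \<longleftrightarrow> T \<subseteq> P \<and> T \<noteq> {} \<and> (\<forall>B\<in>T. u B \<in> F B \<inter> H \<and> u B \<noteq> 0) \<and> (\<Sum>B\<in>T. u B) = 0"
    for T and u :: "'i set \<Rightarrow> 'a"
  have support: "R {B \<in> T. u B \<noteq> 0} u"
    if "T \<subseteq> P" "\<forall>B\<in>T. u B \<in> F B \<inter> H" "(\<Sum>B\<in>T. u B) = 0" "\<exists>B\<in>T. u B \<noteq> 0" for T u
  proof -
    have "(\<Sum>B\<in>{B \<in> T. u B \<noteq> 0}. u B) = (\<Sum>B\<in>T. u B)"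
      by (rule sum.mono_neutral_left) auto
    then show ?thesis
      using that unfolding R_def by auto
  qed
  have "\<exists>T. \<exists>u. R T u"
    using support[of P u] u by blast
  \<comment> \<open>The number of terms is minimal over all relations, whatever their vectors; new
    relations built from subspans of these terms can thus be excluded.\<close>
  then obtain T where "\<exists>u. R T u" and min: "\<And>T' u'. R T' u' \<Longrightarrow> card T \<le> card T'"
    using ex_has_least_nat[of "\<lambda>T. \<exists>u. R T u" _ card] by metis
  then obtain u where "R T u"
    by blast
  then have T: "T \<subseteq> P" "T \<noteq> {}" and uT: "\<And>B. B \<in> T \<Longrightarrow> u B \<in> F B \<inter> H" "\<And>B. B \<in> T \<Longrightarrow> u B \<noteq> 0"
    and sum0: "(\<Sum>B\<in>T. u B) = 0"
    by (auto simp: R_def)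
  have finT: "finite T" by simp
  have "card T \<noteq> 1"
    using uT(2) sum0 by (auto simp: card_1_singleton_iff)
  then have card: "2 \<le> card T"
    using T(2) finT by (metis One_nat_def Suc_1 Suc_leI card_0_eq le_neq_implies_less less_one not_gr_zero
        nat_neq_iff)
  have secL: "x \<in> L (\<Union>T)" if "B \<in> T" "x \<in> F B" "x \<bullet> z = 0" for B x
    using tight[of B] L_mono[of B "\<Union>T"] that T(1) by (auto simp: tight_def H_def)
  obtain t where t: "t \<in> T"
    using T(2) by blast
  \<comment> \<open>A reference vector off \<open>H\<close>, common to all blocks: every flat in the
    relation will be reduced to multiples of \<open>e\<close> modulo
    \<open>L (\<Union>T)\<close>.\<close>
  obtain e where e: "e \<in> F t" "e \<bullet> z = 1"
  proof -
    obtain i where i: "i \<in> t"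
      using t T(1) ne by (metis equals0I subsetD)
    obtain v where v: "v \<in> G i" "v \<bullet> z \<noteq> 0"
      using nondegenerate by blast
    have "v \<in> F t"
      unfolding F_def using v i by (auto intro: span_base)
    then show thesis
      using v by (intro that[of "(1 / (v \<bullet> z)) *\<^sub>R v"]) (auto intro: subspace_scale[OF subspace_F])
  qed
  have main: "x - (x \<bullet> z) *\<^sub>R e \<in> L (\<Union>T)" if s: "s \<in> T" and x: "x \<in> F s" for s x
  proof (cases "s = t")
    case True
    then show ?thesis
      using secL[OF t, of "x - (x \<bullet> z) *\<^sub>R e"] x e
      by (simp add: subspace_diff subspace_scale subspace_F inner_diff_left)
  next
    case False
    define Y where "Y = u ` (T - {s, t})"
    \<comment> \<open>Otherwise, expanding \<open>u s\<close> in \<open>Y\<close> would produce a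
      relation omitting \<open>t\<close>, against minimality.\<close>
    have "u s \<notin> span Y"
    proof
      assume "u s \<in> span Y"
      also have "span Y \<subseteq> span (\<Union>B\<in>T - {s, t}. span {u B})"
        unfolding Y_def by (intro span_mono) (auto intro: span_base)
      finally obtain v where v: "\<forall>B\<in>T - {s, t}. v B \<in> span {u B}" "u s = (\<Sum>B\<in>T - {s, t}. v B)"
        using span_UN_subspaces[of "T - {s, t}" "\<lambda>B. span {u B}"] by auto
      define v' where "v' = v(s := - u s)"
      have "T - {t} = insert s (T - {s, t})"
        using s False by auto
      then have "(\<Sum>B\<in>T - {t}. v' B) = v' s + (\<Sum>B\<in>T - {s, t}. v' B)"
        by simp
      also have "(\<Sum>B\<in>T - {s, t}. v' B) = u s"
        unfolding v(2) by (rule sum.cong) (auto simp: v'_def)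
      finally have "(\<Sum>B\<in>T - {t}. v' B) = 0"
        by (simp add: v'_def)
      moreover have "v' B \<in> F B \<inter> H" if "B \<in> T - {t}" for B
      proof (cases "B = s")
        case True
        then show ?thesis
          using uT(1)[OF s] by (auto simp: v'_def subspace_neg subspace_F subspace_H)
      next
        case False
        then have "v' B \<in> span {u B}"
          using v(1) that by (auto simp: v'_def)
        also have "\<dots> \<subseteq> F B \<inter> H"
          using uT(1)[of B] that by (intro span_minimal subspace_inter subspace_F subspace_H) auto
        finally show ?thesis .
      qed
      moreover have "v' s \<noteq> 0"
        using uT(2)[OF s] by (simp add: v'_def)
      ultimately have "R {B \<in> T - {t}. v' B \<noteq> 0} v'"
        using support[of "T - {t}" v'] T(1) s False by blast
      then have "card T \<le> card {B \<in> T - {t}. v' B \<noteq> 0}"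
        by (rule min)
      also have "\<dots> \<le> card (T - {t})"
        by (intro card_mono) auto
      also have "\<dots> < card T"
        using t by (intro psubset_card_mono) auto
      finally show False by simp
    qed
    \<comment> \<open>The part \<open>w\<close> of \<open>u s\<close> orthogonal to \<open>Y\<close>
      annihilates all terms outside \<open>s\<close> and \<open>t\<close>, but not
      \<open>u s\<close> itself.\<close>
    obtain y w where yw: "y \<in> span Y" "\<And>v. v \<in> span Y \<Longrightarrow> orthogonal w v" "u s = y + w"
      using orthogonal_subspace_decomp_exists[of Y "u s"] by metis
    define \<alpha> where "\<alpha> = u s \<bullet> w"
    have "w \<noteq> 0"
      using yw \<open>u s \<notin> span Y\<close> by auto
    moreover have "\<alpha> = w \<bullet> w"
      using yw(2)[OF yw(1)] by (simp add: \<alpha>_def yw(3) inner_add_left inner_add_right orthogonal_def inner_commute)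
    ultimately have \<alpha>: "\<alpha> \<noteq> 0"
      by simp
    have uw: "u B \<bullet> w = 0" if "B \<in> T - {s, t}" for B
      using yw(2)[of "u B"] that by (auto simp: Y_def orthogonal_def inner_commute intro: span_base)
    have split: "(\<Sum>B\<in>T. f B) = f s + f t + (\<Sum>B\<in>T - {s, t}. f B)" for f :: "'i set \<Rightarrow> 'b::comm_monoid_add"
    proof -
      have "T = insert s (insert t (T - {s, t}))"
        using s t by auto
      then have "(\<Sum>B\<in>T. f B) = (\<Sum>B\<in>insert s (insert t (T - {s, t})). f B)"
        by simp
      also have "\<dots> = f s + f t + (\<Sum>B\<in>T - {s, t}. f B)"
        using False by (simp add: add.assoc)
      finally show ?thesis .
    qed
    obtain D where D: "D \<in> \<Delta>" "\<And>v. v \<in> F UNIV \<Longrightarrow> v \<bullet> dmap D z = v \<bullet> w"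
      using ex_derivation_F[of UNIV w] by blast
    note der = derivation[OF D(1)]
    define d where "d B = dmap D (u B)" for B
    have dF: "d B \<in> F B" if "B \<in> T" for B
      using dmap_F[OF D(1)] uT(1)[OF that] by (simp add: d_def)
    \<comment> \<open>This is the derivative of the identity
      \<open>u B \<bullet> z = 0\<close>.\<close>
    have dz: "d B \<bullet> z = - (u B \<bullet> w)" if "B \<in> T" for B
    proof -
      have "u B \<in> F UNIV"
        using uT(1)[OF that] unfolding F_def using span_mono[of "\<Union>i\<in>B. G i" "\<Union>i. G i"] by blast
      moreover have "D (u B \<bullet> z) = 0"
        using uT(1)[OF that] der by (simp add: H_def derivation_on_0)
      ultimately show ?thesis
        using dmap_inner[OF der, of "u B" z] by (simp add: d_def D(2))
    qed
    have "(\<Sum>B\<in>T. d B) = 0"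
      using dmap_sum[OF der, of u T] by (simp add: d_def sum0 dmap_0 der)
    then have "d s + d t = - (\<Sum>B\<in>T - {s, t}. d B)"
      using split[of d] by (simp add: eq_neg_iff_add_eq_0)
    moreover have "(\<Sum>B\<in>T - {s, t}. d B) \<in> L (\<Union>T)"
    proof (rule subspace_sum[OF subspace_L])
      fix B assume "B \<in> T - {s, t}"
      then show "d B \<in> L (\<Union>T)"
        using secL[of B "d B"] dF[of B] dz[of B] uw[of B] by simp
    qed
    ultimately have dst: "d s + d t \<in> L (\<Union>T)"
      by (simp add: subspace_neg subspace_L)
    have "(\<Sum>B\<in>T. u B \<bullet> w) = 0"
      using sum0 by (simp flip: inner_sum_left)
    then have "u t \<bullet> w = - \<alpha>"
      using split[of "\<lambda>B. u B \<bullet> w"] uw by (simp add: \<alpha>_def)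
    then have dz': "d s \<bullet> z = - \<alpha>" "d t \<bullet> z = \<alpha>"
      using dz s t by (simp_all add: \<alpha>_def)
    \<comment> \<open>The multiple of \<open>d s\<close> that moves \<open>x\<close> into
      \<open>H\<close>. The same coefficient serves \<open>t\<close>, because \<open>d s\<close> and
      \<open>d t\<close> have opposite products with \<open>z\<close>, and their sum is already
      known to lie in \<open>L (\<Union>T)\<close>.\<close>
    define c where "c = (x \<bullet> z) / \<alpha>"
    have "x + c *\<^sub>R d s \<in> L (\<Union>T)"
      using \<alpha> x dF[OF s] by (intro secL[OF s])
        (auto simp: c_def dz' inner_add_left intro: subspace_add[OF subspace_F] subspace_scale[OF subspace_F])
    moreover have "c *\<^sub>R d t - (x \<bullet> z) *\<^sub>R e \<in> L (\<Union>T)"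
      using \<alpha> e dF[OF t] by (intro secL[OF t])
        (auto simp: c_def dz' inner_diff_left intro: subspace_diff[OF subspace_F] subspace_scale[OF subspace_F])
    ultimately have "(x + c *\<^sub>R d s) + (c *\<^sub>R d t - (x \<bullet> z) *\<^sub>R e) - c *\<^sub>R (d s + d t) \<in> L (\<Union>T)"
      by (rule subspace_diff[OF subspace_L subspace_add[OF subspace_L] subspace_scale[OF subspace_L dst]])
    then show ?thesis
      by (simp add: algebra_simps)
  qed
  have all: "x - (x \<bullet> z) *\<^sub>R e \<in> L (\<Union>T)" if "x \<in> F (\<Union>T)" for x
    using that unfolding F_def
  proof (induction rule: span_induct_alt)
    case base
    then show ?case
      by (simp add: subspace_0 subspace_L)
  next
    case (step c x y)
    then obtain i B where B: "B \<in> T" "i \<in> B" "x \<in> G i"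
      by auto
    then have "x \<in> F B"
      unfolding F_def by (auto intro: span_base)
    then have "c *\<^sub>R (x - (x \<bullet> z) *\<^sub>R e) + (y - (y \<bullet> z) *\<^sub>R e) \<in> L (\<Union>T)"
      using main[OF B(1)] step by (simp add: subspace_add subspace_scale subspace_L)
    then show ?case
      by (simp add: inner_add_left algebra_simps)
  qed
  have "tight (\<Union>T)"
    unfolding tight_def H_def
  proof
    fix x assume "x \<in> F (\<Union>T) \<inter> {v. v \<bullet> z = 0}"
    then show "x \<in> L (\<Union>T)"
      using all[of x] by simp
  qed
  then show thesis
    by (rule that[OF T(1) card])
qed

text \<open>Among the partitions into tight blocks, which include the one into singletons, one with
  the fewest blocks is taken. A relation between its sections would allow several blocks to be
  merged into one tight block; hence the sections are independent and their dimensions add up inside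
  \<open>L UNIV\<close>.\<close>

theorem dim_hyperplane_sections:
  obtains P where "partition_on UNIV P" "(\<Sum>B\<in>P. dim (F B) - 1) \<le> dim (L UNIV)"
proof -
  define Q where "Q P \<longleftrightarrow> partition_on (UNIV :: 'i set) P \<and> (\<forall>B\<in>P. tight B)" for P
  have "Q ((\<lambda>i. {i}) ` UNIV)"
    unfolding Q_def using partition_on_singletons[of UNIV] subspace_G
    by (auto simp: tight_def F_def L_def span_eq_iff[THEN iffD2] intro: span_base)
  then obtain P where "Q P" and min: "\<And>P'. Q P' \<Longrightarrow> card P \<le> card P'"
    using ex_has_least_nat[of Q _ card] by metis
  then have P: "partition_on UNIV P" and tight: "\<And>B. B \<in> P \<Longrightarrow> tight B"
    by (auto simp: Q_def)
  have "\<forall>B\<in>P. u B = 0" if u: "\<forall>B\<in>P. u B \<in> F B \<inter> H" "(\<Sum>B\<in>P. u B) = 0" for u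
  proof (rule ccontr)
    assume "\<not> (\<forall>B\<in>P. u B = 0)"
    then have "\<exists>B\<in>P. u B \<noteq> 0"
      by blast
    then obtain T where T: "T \<subseteq> P" "2 \<le> card T" "tight (\<Union>T)"
      using ex_tight_Union[of P u] tight u partition_onD3[OF P] by metis
    have "T \<noteq> {}"
      using T(2) by auto
    have "partition_on UNIV (insert (\<Union>T) (P - T))"
    proof (rule partition_onI)
      show "\<Union>(insert (\<Union>T) (P - T)) = UNIV"
        using partition_onD1[OF P] Un_Diff_cancel[of T P] T(1)
        by (metis Union_Un_distrib Union_insert sup.absorb2)
      have "{} \<notin> P"
        using partition_onD3[OF P] .
      then show "{} \<notin> insert (\<Union>T) (P - T)"
        using T(1) \<open>T \<noteq> {}\<close> by (metis Diff_iff Union_empty_conv ex_in_conv insertE subsetD)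
      have dis: "disjnt p q" if "p \<in> P" "q \<in> P" "p \<noteq> q" for p q
        using partition_onD2[OF P] that by (auto simp: pairwise_def)
      have *: "disjnt (\<Union>T) q" if "q \<in> P - T" for q
        unfolding disjnt_Union1 using dis[of _ q] T(1) that by auto
      fix p q assume "p \<in> insert (\<Union>T) (P - T)" "q \<in> insert (\<Union>T) (P - T)" "p \<noteq> q"
      then show "disjnt p q"
        using *[of p] *[of q] dis[of p q] disjnt_sym[of "\<Union>T"] by (elim insertE) auto
    qed
    then have "Q (insert (\<Union>T) (P - T))"
      using tight T(3) by (auto simp: Q_def)
    then have "card P \<le> card (insert (\<Union>T) (P - T))"
      by (rule min)
    also have "\<dots> \<le> Suc (card (P - T))"
      by (rule card_insert_le_m1) auto
    also have "\<dots> = Suc (card P - card T)"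
      using T(1) by (simp add: card_Diff_subset)
    finally show False
      using T(2) card_mono[OF _ T(1)] by simp
  qed
  then have "dim (span (\<Union>B\<in>P. F B \<inter> H)) = (\<Sum>B\<in>P. dim (F B \<inter> H))"
    by (intro dim_span_UN_independent) (auto intro: subspace_inter subspace_F subspace_H)
  moreover have "(\<Sum>B\<in>P. dim (F B) - 1) \<le> (\<Sum>B\<in>P. dim (F B \<inter> H))"
    unfolding H_def by (intro sum_mono dim_hyperplane_section_ge subspace_F)
  moreover have "span (\<Union>B\<in>P. F B \<inter> H) \<subseteq> L UNIV"
    using tight L_mono[of _ UNIV] by (intro span_minimal subspace_L) (auto simp: tight_def)
  then have "dim (span (\<Union>B\<in>P. F B \<inter> H)) \<le> dim (L UNIV)"
    by (rule dim_subset)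
  ultimately show thesis
    using that P by simp
qed

end

section \<open>Complex subspaces and their projections\<close>

lemma dmap_nth: "dmap D x $ i = dmap D (x $ i)" for x :: "'a::euclidean_space ^ 'n"
proof (rule euclidean_eqI)
  fix b :: 'a assume b: "b \<in> Basis"
  then have "axis i b \<in> Basis"
    by (auto simp: Basis_vec_def)
  then show "dmap D x $ i \<bullet> b = dmap D (x $ i) \<bullet> b"
    using dmap_inner_Basis[of "axis i b" D x] b by (simp add: inner_axis dmap_inner_Basis)
qed

lemma inner_axis_left: "axis i a \<bullet> x = a \<bullet> x $ i" for x :: "'a::euclidean_space ^ 'n"
  by (simp add: inner_commute[of "axis i a"] inner_axis inner_commute)

lemma scaleR_eq_vec_scale: "c *\<^sub>R v = of_real c *s v" for v :: "complex ^ 'n"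
  by (simp add: vec_eq_iff scaleR_conv_of_real[symmetric])

lemma subspace_if_vec_subspace: "vec.subspace V \<Longrightarrow> subspace V" for V :: "(complex ^ 'n) set"
  by (simp add: subspace_def vec.subspace_def scaleR_eq_vec_scale)

lemma dim_complex_line:
  fixes b :: "complex ^ 'n"
  assumes "b \<noteq> 0"
  shows "dim (range (\<lambda>c. c *s b)) = 2"
proof -
  have lin: "linear (\<lambda>c. c *s b)"
    by (rule linearI) (simp_all add: vec_eq_iff algebra_simps scaleR_conv_of_real[symmetric])
  have "inj (\<lambda>c. c *s b)"
    using assms by (auto intro!: injI simp: vec_eq_iff)
  then have "dim (range (\<lambda>c. c *s b)) = dim (UNIV :: complex set)"
    using lin by (intro dim_image_eq) (auto intro: inj_on_subset)
  then show ?thesis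
    by simp
qed

lemma dim_vec_span:
  fixes B :: "(complex ^ 'n) set"
  assumes "finite B" "vec.independent B"
  shows "dim (vec.span B) = 2 * card B"
  using assms
proof (induction B rule: finite_induct)
  case empty
  then show ?case by (simp add: vec.span_empty)
next
  case (insert b B)
  then have B: "vec.independent B" and b: "b \<notin> vec.span B"
    by (auto simp: vec.independent_insert)
  have sub: "subspace (range (\<lambda>c. c *s b))" "subspace (vec.span B)"
  proof -
    show "subspace (vec.span B)"
      by (intro subspace_if_vec_subspace vec.subspace_span)
    have "range (\<lambda>c. c *s b) = vec.span {b}"
      by (simp add: vec.span_singleton)
    then show "subspace (range (\<lambda>c. c *s b))"
      by (metis subspace_if_vec_subspace vec.subspace_span)
  qed
  have "vec.span (insert b B) = {x + y |x y. x \<in> range (\<lambda>c. c *s b) \<and> y \<in> vec.span B}"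
    using vec.span_Un[of "{b}" B] by (auto simp: vec.span_singleton)
  moreover have "range (\<lambda>c. c *s b) \<inter> vec.span B \<subseteq> {0}"
  proof
    fix x assume x: "x \<in> range (\<lambda>c. c *s b) \<inter> vec.span B"
    then obtain c where c: "x = c *s b" "c *s b \<in> vec.span B"
      by auto
    have "c = 0"
    proof (rule ccontr)
      assume "c \<noteq> 0"
      then have "b = inverse c *s (c *s b)"
        by simp
      then show False
        using b vec.span_scale[OF c(2), of "inverse c"] by simp
    qed
    then show "x \<in> {0}"
      using c by simp
  qed
  moreover have "b \<noteq> 0"
    using b vec.span_zero by auto
  ultimately show ?case
    using dim_sums_Int[OF sub] insert.hyps insert.IH[OF B] dim_complex_line[of b]
    by (simp add: dim_eq_0[THEN iffD2])
qed

lemma dim_eq_double_vec_dim: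
  fixes W :: "(complex ^ 'n) set"
  assumes "vec.subspace W"
  shows "dim W = 2 * vec.dim W"
proof -
  obtain B where B: "B \<subseteq> W" "vec.independent B" "W \<subseteq> vec.span B" "card B = vec.dim W"
    using vec.basis_exists by blast
  have "vec.span B = W"
    using B(1,3) assms vec.span_minimal by blast
  moreover have "finite B"
    using B(2) vec.finiteI_independent by blast
  ultimately show ?thesis
    using dim_vec_span[OF _ B(2)] B(4) by simp
qed

text \<open>\<open>P \<circ> Q\<close> and \<open>Q \<circ> P\<close> are transposes, and this is
  one half of the equality of their ranks. The squared length of \<open>P (Q c)\<close> is
  \<open>Q (P (Q c)) \<bullet> c\<close>, so \<open>Q\<close> is injective on the image of
  \<open>P \<circ> Q\<close>.\<close>

lemma dim_image_projections_le:
  fixes P Q :: "'a::euclidean_space \<Rightarrow> 'a"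
  assumes P: "linear P" "\<And>x y. P x \<bullet> y = x \<bullet> P y" "\<And>x. P (P x) = P x"
    and Q: "linear Q" "\<And>x y. Q x \<bullet> y = x \<bullet> Q y"
  shows "dim (P ` range Q) \<le> dim (Q ` range P)"
proof -
  have lin: "linear (P \<circ> Q)"
    by (rule linear_compose[OF Q(1) P(1)])
  have 0: "P (Q c) = 0" if "Q (P (Q c)) = 0" for c
  proof -
    have "P (Q c) \<bullet> P (Q c) = Q (P (Q c)) \<bullet> c"
      by (simp add: P(2,3) Q(2))
    then show ?thesis
      using that by simp
  qed
  have "subspace (range (P \<circ> Q))"
    using lin by (intro linear_subspace_image) simp_all
  then have sub: "span (P ` range Q) = P ` range Q"
    by (simp add: span_eq_iff image_comp)
  have "inj_on Q (P ` range Q)"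
  proof (rule inj_onI, clarify)
    fix a b assume "Q (P (Q a)) = Q (P (Q b))"
    then have "Q (P (Q (a - b))) = 0"
      by (simp add: linear_diff P(1) Q(1))
    then have "P (Q (a - b)) = 0"
      by (rule 0)
    then show "P (Q a) = P (Q b)"
      by (simp add: linear_diff P(1) Q(1))
  qed
  then have "dim (P ` range Q) = dim (Q ` P ` range Q)"
    using Q(1) by (subst dim_image_eq) (simp_all only: sub)
  also have "\<dots> \<le> dim (Q ` range P)"
    by (rule dim_subset) auto
  finally show ?thesis .
qed

text \<open>\<open>K\<close> collects the coordinates of an orthonormal basis of \<open>V\<close>. A
  derivation killing them treats the basis vectors as constants and therefore commutes with the
  formula for \<open>P\<close>.\<close>

lemma ex_orthogonal_projection:
  fixes V :: "'a::euclidean_space set"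
  assumes "subspace V"
  obtains P K where "linear P" "\<And>x. P x \<in> V" "\<And>v. v \<in> V \<Longrightarrow> P v = v"
    "\<And>x y. P x \<bullet> y = x \<bullet> P y" "countable K"
    "\<And>D x. derivation_on UNIV D \<Longrightarrow> (\<And>y. y \<in> K \<Longrightarrow> D y = 0) \<Longrightarrow> dmap D (P x) = P (dmap D x)"
proof -
  obtain B where B: "B \<subseteq> V" "pairwise orthogonal B" "\<And>x. x \<in> B \<Longrightarrow> norm x = 1"
    "independent B" "span B = V"
    using orthonormal_basis_subspace[OF assms] by metis
  have fin: "finite B"
    using B(4) by (rule finiteI_independent)
  define P where "P x = (\<Sum>b\<in>B. (x \<bullet> b) *\<^sub>R b)" for x
  define K where "K = (\<lambda>(b, e). b \<bullet> e) ` (B \<times> (Basis :: 'a set))"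
  have "linear P"
    by (rule linearI)
       (simp_all add: P_def inner_add_left scaleR_add_left sum.distrib scaleR_sum_right)
  moreover have "P x \<in> V" for x
    unfolding P_def using B(1) by (intro subspace_sum[OF assms] subspace_scale[OF assms]) auto
  moreover have "P b = b" if "b \<in> B" for b
  proof -
    have "P b = (\<Sum>c\<in>B. if c = b then b else 0)"
      unfolding P_def using B(2,3) that
      by (intro sum.cong) (auto simp: pairwise_def orthogonal_def norm_eq_1)
    then show ?thesis
      using that fin by simp
  qed
  then have "P v = v" if "v \<in> V" for v
    using that linear_eq_on[OF \<open>linear P\<close> linear_id, of v B] by (auto simp: B(5))
  moreover have "P x \<bullet> y = x \<bullet> P y" for x y
    by (simp add: P_def inner_sum_left inner_sum_right inner_commute mult.commute)
  moreover have "countable K"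
    by (simp add: K_def countable_finite fin)
  moreover have "dmap D (P x) = P (dmap D x)"
    if D: "derivation_on UNIV D" "\<And>y. y \<in> K \<Longrightarrow> D y = 0" for D x
  proof -
    have "dmap D b = 0" if "b \<in> B" for b
    proof (rule euclidean_eqI)
      fix e :: 'a assume "e \<in> Basis"
      then have "b \<bullet> e \<in> K"
        using that by (auto simp: K_def)
      then show "dmap D b \<bullet> e = 0 \<bullet> e"
        using D(2) \<open>e \<in> Basis\<close> by (simp add: dmap_inner_Basis)
    qed
    then show ?thesis
      by (simp add: P_def dmap_sum[OF D(1)] dmap_scaleR[OF D(1)] dmap_inner[OF D(1)])
  qed
  ultimately show thesis
    using that[of P K] by simp
qed

lemma coord_proj_linear: "linear (coord_proj S)"
  by (rule linearI) (auto simp: coord_proj_def vec_eq_iff)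

lemma coord_proj_inner: "coord_proj S x \<bullet> y = x \<bullet> coord_proj S y"
  by (auto simp: coord_proj_def inner_vec_def intro!: sum.cong)

lemma coord_proj_idem: "coord_proj S (coord_proj S x) = coord_proj S x"
  by (auto simp: coord_proj_def vec_eq_iff)

lemma vec_subspace_coord_proj:
  assumes "vec.subspace V"
  shows "vec.subspace (coord_proj S ` V)"
proof -
  have 0: "0 = coord_proj S 0"
    and add: "coord_proj S x + coord_proj S y = coord_proj S (x + y)"
    and scale: "c *s coord_proj S x = coord_proj S (c *s x)" for x y c
    by (auto simp: coord_proj_def vec_eq_iff)
  have V: "0 \<in> V" "\<And>x y. x \<in> V \<Longrightarrow> y \<in> V \<Longrightarrow> x + y \<in> V" "\<And>c x. x \<in> V \<Longrightarrow> c *s x \<in> V"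
    using assms by (auto simp: vec.subspace_def)
  show ?thesis
    unfolding vec.subspace_def
  proof (intro conjI ballI allI)
    show "0 \<in> coord_proj S ` V"
      using V(1) 0 by (metis imageI)
  qed (auto simp: add scale V)
qed

lemma span_axes: "span (\<Union>i\<in>S. range (axis i)) = range (coord_proj S)"
  for S :: "'n::finite set"
proof
  show "span (\<Union>i\<in>S. range (axis i)) \<subseteq> range (coord_proj S)"
  proof (rule span_minimal)
    show "subspace (range (coord_proj S))"
      using coord_proj_linear by (intro linear_subspace_image) simp_all
    have "axis i a = coord_proj S (axis i a)" if "i \<in> S" for i a
      using that by (auto simp: coord_proj_def axis_def vec_eq_iff)
    then show "(\<Union>i\<in>S. range (axis i)) \<subseteq> range (coord_proj S)"
      by blast
  qed
  show "range (coord_proj S) \<subseteq> span (\<Union>i\<in>S. range (axis i))"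
  proof clarify
    fix x
    have "coord_proj S x = (\<Sum>i\<in>S. axis i (x $ i))"
      by (auto simp: coord_proj_def vec_eq_iff axis_def if_distrib cong: if_cong)
    also have "\<dots> \<in> span (\<Union>i\<in>S. range (axis i))"
      by (intro span_sum span_base) auto
    finally show "coord_proj S x \<in> span (\<Union>i\<in>S. range (axis i))" .
  qed
qed

section \<open>Real functionals on the linear space and their flats\<close>

locale linear_amoeba =
  fixes V :: "(complex ^ 'n) set" and P :: "complex ^ 'n \<Rightarrow> complex ^ 'n" and K :: "real set"
  assumes V: "vec.subspace V"
    and coord_nonzero: "\<exists>v\<in>V. v $ i \<noteq> 0"
    and P_linear: "linear P"
    and P_in: "P x \<in> V"
    and P_id: "v \<in> V \<Longrightarrow> P v = v"
    and P_inner: "P x \<bullet> y = x \<bullet> P y"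
    and K: "countable K"
    and P_dmap: "derivation_on UNIV D \<Longrightarrow> (\<And>y. y \<in> K \<Longrightarrow> D y = 0) \<Longrightarrow> dmap D (P x) = P (dmap D x)"
begin

definition \<Delta> :: "(real \<Rightarrow> real) set" where
  "\<Delta> = {D. derivation_on UNIV D \<and> (\<forall>y\<in>K. D y = 0)}"

text \<open>By self-adjointness, \<open>P a\<close> represents the functional
  \<open>v \<bullet> a\<close> of \<open>v\<close> on \<open>V\<close>. Under this identification
  the flat consists of the real functionals that factor through the coordinates in
  \<open>B\<close>.\<close>

definition flat :: "'n set \<Rightarrow> (complex ^ 'n) set" where
  "flat B = span (\<Union>i\<in>B. P ` range (axis i))"

text \<open>On \<open>V\<close>, the \<open>i\<close>-th component of the differential of \<open>Log\<close> at \<open>y\<close> is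
  \<open>Re (v $ i / y $ i) = (v \<bullet> grad y i) / (cmod (y $ i))\<^sup>2\<close>.\<close>

definition grad :: "complex ^ 'n \<Rightarrow> 'n \<Rightarrow> complex ^ 'n" where
  "grad y i = P (axis i (y $ i))"

lemma P_idem: "P (P x) = P x"
  by (simp add: P_id P_in)

lemma inner_P_axis: "P (axis i a) \<bullet> v = a \<bullet> P v $ i"
  by (simp add: P_inner inner_axis_left)

lemma range_P: "range P = V"
  using P_in P_id by (metis image_subset_iff rangeI subsetI subset_antisym)

text \<open>The flat is the image of \<open>P \<circ> coord_proj B\<close>, the transpose of the map
  whose image is the coordinate projection of \<open>V\<close>. The ranks agree, and real dimension
  doubles complex dimension.\<close>

lemma dim_flat: "dim (flat B) = 2 * proj_rank V B"
proof -
  have "flat B = P ` range (coord_proj B)"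
    unfolding flat_def using linear_span_image[OF P_linear, of "\<Union>i\<in>B. range (axis i)"]
    by (simp add: span_axes image_UN)
  then have "dim (flat B) = dim (coord_proj B ` range P)"
    using dim_image_projections_le[of P "coord_proj B"] dim_image_projections_le[of "coord_proj B" P]
    by (intro antisym)
       (simp_all add: P_linear P_inner P_idem coord_proj_linear coord_proj_inner coord_proj_idem)
  also have "\<dots> = 2 * proj_rank V B"
    unfolding range_P proj_rank_def
    by (intro dim_eq_double_vec_dim vec_subspace_coord_proj V)
  finally show ?thesis .
qed

lemma dmap_flat_generator:
  assumes "D \<in> \<Delta>" "v \<in> P ` range (axis i)"
  shows "dmap D v \<in> P ` range (axis i)"
proof -
  obtain a where v: "v = P (axis i a)"
    using assms(2) by auto
  have D: "derivation_on UNIV D" "\<And>y. y \<in> K \<Longrightarrow> D y = 0"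
    using assms(1) by (auto simp: \<Delta>_def)
  have "dmap D (axis i a) = axis i (dmap D a)"
    using dmap_0[OF D(1)] by (auto simp: vec_eq_iff dmap_nth axis_def)
  then show ?thesis
    unfolding v by (subst P_dmap[OF D]) auto
qed

text \<open>Rotating all coordinates by a common phase preserves moduli, so every gradient is
  orthogonal to the infinitesimal rotation \<open>\<i> *s y\<close>. The flat of a nonempty block is
  not contained in that hyperplane, so every block loses a dimension.\<close>

lemma dim_grad_le:
  assumes y: "y \<in> V" "y \<in> torus" and Q: "partition_on UNIV Q"
  shows "dim (span (range (grad y))) \<le> (\<Sum>B\<in>Q. 2 * proj_rank V B - 1)"
proof -
  have "\<Union>Q = UNIV"
    using partition_onD1[OF Q] by simp
  have "span (range (grad y)) \<subseteq> span (\<Union>B\<in>Q. grad y ` B)"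
    using \<open>\<Union>Q = UNIV\<close> by (intro span_mono) auto
  then have "dim (span (range (grad y))) \<le> dim (span (\<Union>B\<in>Q. grad y ` B))"
    by (rule dim_subset)
  also have "\<dots> \<le> (\<Sum>B\<in>Q. dim (grad y ` B))"
    by (rule dim_span_UN_le) simp
  also have "\<dots> \<le> (\<Sum>B\<in>Q. 2 * proj_rank V B - 1)"
  proof (rule sum_mono)
    fix B assume "B \<in> Q"
    then obtain i where i: "i \<in> B"
      using partition_onD3[OF Q] by (metis equals0I)
    let ?z = "\<i> *s y"
    have z: "P ?z = ?z"
      using y V by (intro P_id) (simp add: vec.subspace_def)
    have "grad y ` B \<subseteq> flat B \<inter> {x. x \<bullet> ?z = 0}"
    proof
      fix x assume "x \<in> grad y ` B"
      then obtain j where j: "j \<in> B" "x = P (axis j (y $ j))"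
        by (auto simp: grad_def)
      have "x \<in> flat B"
        unfolding flat_def j(2) using j(1) by (intro span_base) auto
      moreover have "x \<bullet> ?z = 0"
        unfolding j(2) inner_P_axis z by (simp add: inner_complex_def)
      ultimately show "x \<in> flat B \<inter> {x. x \<bullet> ?z = 0}"
        by simp
    qed
    then have "dim (grad y ` B) \<le> dim (flat B \<inter> {x. x \<bullet> ?z = 0})"
      by (rule dim_subset)
    also have "\<dots> < dim (flat B)"
    proof (rule dim_hyperplane_section_le)
      show "subspace (flat B)"
        by (simp add: flat_def)
      show "P (axis i (?z $ i)) \<in> flat B"
        unfolding flat_def using i by (intro span_base) auto
      \<comment> \<open>The product is the squared modulus of \<open>y $ i\<close>.\<close>
      show "P (axis i (?z $ i)) \<bullet> ?z \<noteq> 0"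
        unfolding inner_P_axis z using y(2) by (simp add: torus_def)
    qed
    finally show "dim (grad y ` B) \<le> 2 * proj_rank V B - 1"
      by (simp add: dim_flat)
  qed
  finally show ?thesis .
qed

text \<open>The hyperplane belonging to a point is orthogonal to \<open>\<i>\<close> times that
  point. For the generic vector \<open>P y\<close> to define it, the gradients are taken at
  \<open>- \<i>\<close> times \<open>P y\<close>, which has the same moduli.\<close>

lemma ex_generic_in_V:
  assumes N: "open N" "N \<noteq> {}" "P ` N \<subseteq> torus"
  obtains y Q where "y \<in> N" "partition_on UNIV Q"
    "(\<Sum>B\<in>Q. 2 * proj_rank V B - 1) \<le> dim (span (range (grad (- \<i> *s P y))))"
proof -
  obtain y where y: "y \<in> N"
    "\<And>w. \<exists>D. derivation_on UNIV D \<and> (\<forall>y\<in>K. D y = 0) \<and> dmap D y = w"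
    using ex_generic_point[OF N(1,2) K] by metis
  define z where "z = P y"
  have z: "P z = z"
    by (simp add: z_def P_idem)
  have z_nz: "z $ i \<noteq> 0" for i
    using N(3) y(1) by (auto simp: z_def torus_def)
  interpret generic_hyperplane "\<lambda>i. P ` range (axis i)" z \<Delta>
  proof
    show "subspace (P ` range (axis i))" for i
    proof -
      have "linear (axis i :: complex \<Rightarrow> complex ^ 'n)"
        by (rule linearI) (auto simp: axis_def vec_eq_iff)
      then show ?thesis
        using P_linear by (intro linear_subspace_image) simp_all
    qed
    show "derivation_on UNIV D" if "D \<in> \<Delta>" for D
      using that by (simp add: \<Delta>_def)
    show "dmap D v \<in> P ` range (axis i)" if "D \<in> \<Delta>" "v \<in> P ` range (axis i)" for D v i
      using that by (rule dmap_flat_generator)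
    show "\<exists>D\<in>\<Delta>. \<forall>i. \<forall>v\<in>P ` range (axis i). v \<bullet> dmap D z = v \<bullet> w" for w
    proof -
      obtain D where D: "derivation_on UNIV D" "\<forall>y\<in>K. D y = 0" "dmap D y = w"
        using y(2) by metis
      then have "dmap D z = P w"
        by (simp add: z_def P_dmap)
      then have "v \<bullet> dmap D z = v \<bullet> w" if "v \<in> P ` range (axis i)" for v i
        using that by (auto simp: P_inner P_idem)
      then show ?thesis
        using D by (intro bexI[of _ D]) (auto simp: \<Delta>_def)
    qed
    show "\<exists>v\<in>P ` range (axis i). v \<bullet> z \<noteq> 0" for i
      by (rule bexI[of _ "P (axis i (z $ i))"]) (use z_nz[of i] in \<open>auto simp: inner_P_axis z\<close>)
  qed
  obtain Q where Q: "partition_on UNIV Q" "(\<Sum>B\<in>Q. dim (F B) - 1) \<le> dim (L UNIV)"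
    using dim_hyperplane_sections by metis
  have "P ` range (axis i) \<inter> H \<subseteq> span (range (grad (- \<i> *s z)))" for i
  proof
    fix v assume v: "v \<in> P ` range (axis i) \<inter> H"
    then obtain a where a: "v = P (axis i a)" "a \<bullet> z $ i = 0"
      by (auto simp: H_def inner_P_axis z)
    \<comment> \<open>In the complex plane, the numbers orthogonal to \<open>z $ i\<close> form the
      real line through \<open>b\<close>, its rotation by a right angle.\<close>
    define b where "b = - \<i> * z $ i"
    define c where "c = (a \<bullet> b) / (b \<bullet> b)"
    have "b \<bullet> b \<noteq> 0"
      using z_nz[of i] by (simp add: b_def)
    have "a = c *\<^sub>R b"
    proof -
      have ortho: "Re a * Re (z $ i) + Im a * Im (z $ i) = 0"
        using a(2) by (simp add: inner_complex_def)
      have "Im a * (Im (z $ i) * Re (z $ i)) + Re a * (Re (z $ i) * Re (z $ i)) =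
          Re (z $ i) * (Re a * Re (z $ i) + Im a * Im (z $ i))"
        "Im a * (Im (z $ i) * Im (z $ i)) + Re a * (Im (z $ i) * Re (z $ i)) =
          Im (z $ i) * (Re a * Re (z $ i) + Im a * Im (z $ i))"
        by (simp_all add: algebra_simps)
      note zero = this[unfolded ortho mult_zero_right]
      have "(b \<bullet> b) *\<^sub>R a = (a \<bullet> b) *\<^sub>R b"
        unfolding b_def complex_eq_iff inner_complex_def
        by (simp add: algebra_simps zero)
      then have "(1 / (b \<bullet> b)) *\<^sub>R ((b \<bullet> b) *\<^sub>R a) = c *\<^sub>R b"
        by (simp add: c_def)
      then show ?thesis
        using \<open>b \<bullet> b \<noteq> 0\<close> by simp
    qed
    then have "axis i a = c *\<^sub>R axis i b"
      by (simp add: axis_def vec_eq_iff)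
    then have "v = c *\<^sub>R grad (- \<i> *s z) i"
      by (simp add: a(1) grad_def b_def linear_scale[OF P_linear])
    then show "v \<in> span (range (grad (- \<i> *s z)))"
      by (simp only:) (intro span_scale span_base rangeI)
  qed
  then have "L UNIV \<subseteq> span (range (grad (- \<i> *s z)))"
    unfolding L_def by (intro span_minimal) auto
  then have "dim (L UNIV) \<le> dim (span (range (grad (- \<i> *s z))))"
    by (rule dim_subset)
  moreover have "F B = flat B" for B
    by (simp add: F_def flat_def)
  ultimately show thesis
    using that[OF y(1) Q(1)] Q(2) by (simp add: dim_flat z_def)
qed

text \<open>The projection of a generic point avoids all coordinate hyperplanes: a derivation sends
  a vanishing coordinate to zero, yet any vector of \<open>V\<close> occurs as the derivative of the
  projected point.\<close>

lemma ex_in_torus: "V \<inter> torus \<noteq> {}"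
proof -
  obtain y :: "complex ^ 'n"
    where y: "\<And>w. \<exists>D. derivation_on UNIV D \<and> (\<forall>y\<in>K. D y = 0) \<and> dmap D y = w"
    using ex_generic_point[of UNIV K] K by (metis UNIV_not_empty open_UNIV)
  have "P y $ i \<noteq> 0" for i
  proof
    assume i: "P y $ i = 0"
    obtain v where v: "v \<in> V" "v $ i \<noteq> 0"
      using coord_nonzero by blast
    obtain D where D: "derivation_on UNIV D" "\<forall>y\<in>K. D y = 0" "dmap D y = v"
      using y by metis
    have "v = dmap D (P y)"
      using D by (simp add: P_dmap P_id v(1))
    then have "v $ i = 0"
      by (simp add: dmap_nth i dmap_0 D(1))
    then show False
      using v(2) by simp
  qed
  then show ?thesis
    using P_in by (auto simp: torus_def)
qed

end

section \<open>Constant rank and charts\<close>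

text \<open>Linear independence of the family in its dual form, which is the form that derivations
  deliver. It includes injectivity of \<open>l\<close> on \<open>I\<close>, which independence of
  the image set would not see.\<close>

definition jointly_surjective :: "'i set \<Rightarrow> ('i \<Rightarrow> 'a::real_inner) \<Rightarrow> bool" where
  "jointly_surjective I l \<longleftrightarrow> (\<forall>t :: 'i \<Rightarrow> real. \<exists>w. \<forall>i\<in>I. w \<bullet> l i = t i)"

lemma jointly_surjective_scale:
  assumes "jointly_surjective I l" "\<And>i. i \<in> I \<Longrightarrow> c i \<noteq> 0"
  shows "jointly_surjective I (\<lambda>i. c i *\<^sub>R l i)"
  unfolding jointly_surjective_def
proof
  fix t
  obtain w where "\<forall>i\<in>I. w \<bullet> l i = t i / c i"
    using assms(1)[unfolded jointly_surjective_def, rule_format, of "\<lambda>i. t i / c i"] by blast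
  then have "\<forall>i\<in>I. w \<bullet> (c i *\<^sub>R l i) = t i"
    using assms(2) by simp
  then show "\<exists>w. \<forall>i\<in>I. w \<bullet> (c i *\<^sub>R l i) = t i" ..
qed

lemma jointly_surjective_if_independent:
  fixes l :: "'i \<Rightarrow> 'a::euclidean_space"
  assumes "independent (l ` I)" "inj_on l I"
  shows "jointly_surjective I l"
  unfolding jointly_surjective_def
proof
  fix t
  obtain \<phi> :: "'a \<Rightarrow> real" where \<phi>: "linear \<phi>" "\<forall>x\<in>l ` I. \<phi> x = t (inv_into I l x)"
    using linear_independent_extend[OF assms(1), of "\<lambda>x. t (inv_into I l x)"] by metis
  have "(\<Sum>b\<in>Basis. \<phi> b *\<^sub>R b) \<bullet> x = \<phi> x" for x
  proof -
    have "\<phi> x = \<phi> (\<Sum>b\<in>Basis. (x \<bullet> b) *\<^sub>R b)"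
      by (simp add: euclidean_representation)
    also have "\<dots> = (\<Sum>b\<in>Basis. (x \<bullet> b) * \<phi> b)"
      by (simp add: linear_sum[OF \<phi>(1)] linear_scale[OF \<phi>(1)])
    finally show ?thesis
      by (simp add: inner_sum_left inner_commute[of x] mult.commute)
  qed
  then have "\<forall>i\<in>I. (\<Sum>b\<in>Basis. \<phi> b *\<^sub>R b) \<bullet> l i = t i"
    using \<phi>(2) assms(2) by simp
  then show "\<exists>w. \<forall>i\<in>I. w \<bullet> l i = t i" ..
qed

lemma jointly_surjective_imp_independent:
  fixes l :: "'i \<Rightarrow> 'a::euclidean_space"
  assumes "jointly_surjective I l"
  shows "independent (l ` I)" "inj_on l I"
proof -
  have dual: "\<exists>w. \<forall>j\<in>I. w \<bullet> l j = (if j = i then 1 else 0)" for i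
    using assms by (simp add: jointly_surjective_def)
  show inj: "inj_on l I"
  proof (rule inj_onI)
    fix i j assume ij: "i \<in> I" "j \<in> I" "l i = l j"
    obtain w where "\<forall>j\<in>I. w \<bullet> l j = (if j = i then 1 else 0)"
      using dual by metis
    then show "i = j"
      using ij by (metis zero_neq_one)
  qed
  show "independent (l ` I)"
    unfolding dependent_def
  proof
    assume "\<exists>a\<in>l ` I. a \<in> span (l ` I - {a})"
    then obtain i where i: "i \<in> I" "l i \<in> span (l ` I - {l i})"
      by auto
    obtain w where w: "\<forall>j\<in>I. w \<bullet> l j = (if j = i then 1 else 0)"
      using dual by metis
    have "orthogonal w y" if "y \<in> l ` I - {l i}" for y
      using that w by (auto simp: orthogonal_def)
    then have "orthogonal w (l i)"
      using i(2) orthogonal_to_span by blast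
    then show False
      using w i(1) by (simp add: orthogonal_def)
  qed
qed

text \<open>At maximal rank the selected vectors already span all others.\<close>

lemma jointly_surjective_kernel:
  fixes l :: "'i::finite \<Rightarrow> 'a::euclidean_space"
  assumes "jointly_surjective I l" and dim: "dim (span (range l)) \<le> card I"
    and v: "\<And>i. i \<in> I \<Longrightarrow> v \<bullet> l i = 0"
  shows "v \<bullet> l k = 0"
proof -
  have "range l \<subseteq> span (l ` I)"
  proof (rule card_ge_dim_independent)
    show "independent (l ` I)"
      by (rule jointly_surjective_imp_independent) fact
    show "dim (range l) \<le> card (l ` I)"
      using dim card_image[OF jointly_surjective_imp_independent(2)[OF assms(1)]] by simp
  qed auto
  then have "l k \<in> span (l ` I)"
    by auto
  moreover have "orthogonal v y" if "y \<in> l ` I" for y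
    using that v by (auto simp: orthogonal_def)
  ultimately show ?thesis
    using orthogonal_to_span[of "l k" "l ` I" v] by (simp add: orthogonal_def)
qed

text \<open>The inverse function theorem is applied to a map \<open>\<Phi>\<close> that is tangent to the identity at
  \<open>c\<close> and satisfies \<open>\<Phi> z \<bullet> g c i = f z $ i\<close> for \<open>i \<in> I\<close>. In the chart \<open>\<Phi>\<close> the selected components
  are linear, and the others are constant on their level sets because the rank is at most \<open>card I\<close>.\<close>

lemma constant_rank:
  fixes f :: "'a::euclidean_space \<Rightarrow> real ^ 'n" and g :: "'a \<Rightarrow> 'n \<Rightarrow> 'a"
  assumes \<Omega>: "open \<Omega>"
    and der: "\<And>z. z \<in> \<Omega> \<Longrightarrow> (f has_derivative (\<lambda>v. \<chi> i. v \<bullet> g z i)) (at z)"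
    and cont: "\<And>i. continuous_on \<Omega> (\<lambda>z. g z i)"
    and rank: "\<And>z. z \<in> \<Omega> \<Longrightarrow> dim (span (range (g z))) \<le> card I"
    and c: "c \<in> \<Omega>" "jointly_surjective I (g c)"
  obtains N where "open N" "c \<in> N" "N \<subseteq> \<Omega>" "\<And>z. z \<in> N \<Longrightarrow> jointly_surjective I (g z)"
    "\<And>a b. a \<in> N \<Longrightarrow> b \<in> N \<Longrightarrow> (\<And>i. i \<in> I \<Longrightarrow> f a $ i = f b $ i) \<Longrightarrow> f a = f b"
    "\<And>M. open M \<Longrightarrow> M \<subseteq> N \<Longrightarrow> open {y. \<exists>z\<in>M. \<forall>i\<in>I. y $ i = f z $ i}"
proof -
  have "\<exists>w. \<forall>j\<in>I. w \<bullet> g c j = (if j = i then 1 else 0)" for i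
    using c(2) by (simp add: jointly_surjective_def)
  then obtain e where e: "\<And>i j. j \<in> I \<Longrightarrow> e i \<bullet> g c j = (if j = i then 1 else 0)"
    by metis
  have e_sum: "(\<Sum>i\<in>I. s i *\<^sub>R e i) \<bullet> g c j = s j" if "j \<in> I" for s j
    using that by (simp add: inner_sum_left e if_distrib cong: if_cong)
  \<comment> \<open>The correction along the dual family \<open>e\<close> replaces each linear
    component at \<open>c\<close> by the corresponding component of \<open>f\<close>. Its derivative
    vanishes at \<open>c\<close>.\<close>
  define \<Phi> where "\<Phi> z = z + (\<Sum>i\<in>I. (f z $ i - z \<bullet> g c i) *\<^sub>R e i)" for z
  define \<Phi>' where "\<Phi>' z = id_blinfun +
    (\<Sum>i\<in>I. blinfun_scaleR_left (e i) o\<^sub>L blinfun_inner_right (g z i - g c i))" for z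
  have \<Phi>'_apply: "blinfun_apply (\<Phi>' z) h = h + (\<Sum>i\<in>I. ((g z i - g c i) \<bullet> h) *\<^sub>R e i)" for z h
    by (simp add: \<Phi>'_def blinfun.add_left blinfun.sum_left)
  have \<Phi>_inner: "\<Phi> z \<bullet> g c j = f z $ j" if "j \<in> I" for z j
    using that by (simp add: \<Phi>_def inner_add_left e_sum)
  have \<Phi>'_inner: "blinfun_apply (\<Phi>' z) h \<bullet> g c j = h \<bullet> g z j" if "j \<in> I" for z h j
    using that by (simp add: \<Phi>'_apply inner_add_left e_sum inner_diff_right inner_commute[of _ h])
  have der_nth: "((\<lambda>z. f z $ i) has_derivative (\<lambda>v. v \<bullet> g z i)) (at z)" if "z \<in> \<Omega>" for z i
    using bounded_linear.has_derivative[OF bounded_linear_vec_nth der[OF that], of i] by simp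
  have "(\<Phi> has_derivative blinfun_apply (\<Phi>' z)) (at z)" if "z \<in> \<Omega>" for z
    unfolding \<Phi>_def
    by (rule derivative_eq_intros der_nth[OF that] refl | simp)+
       (auto simp: \<Phi>'_apply fun_eq_iff inner_diff_left inner_diff_right inner_commute)
  moreover have "continuous_on \<Omega> \<Phi>'"
    unfolding \<Phi>'_def
    by (intro continuous_intros cont bounded_linear.continuous_on[OF bounded_linear_blinfun_inner_right])
  moreover have "id_blinfun o\<^sub>L \<Phi>' c = id_blinfun"
    by (rule blinfun_eqI) (simp add: \<Phi>'_apply)
  ultimately obtain U' W h h' where U': "open U'" "U' \<subseteq> \<Omega>" "c \<in> U'"
    and W: "open W" "\<Phi> c \<in> W" and hom: "homeomorphism U' W \<Phi> h"
    and h': "\<And>y. y \<in> W \<Longrightarrow> (h has_derivative (h' y)) (at y)"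
      "\<And>y. y \<in> W \<Longrightarrow> h' y = inv_into UNIV (blinfun_apply (\<Phi>' (h y)))"
      "\<And>y. y \<in> W \<Longrightarrow> bij (blinfun_apply (\<Phi>' (h y)))"
    using inverse_function_theorem[OF \<Omega> _ _ c(1), of \<Phi> \<Phi>' id_blinfun] by metis
  \<comment> \<open>A ball is taken because segments between chart points have to stay inside
    \<open>W\<close>.\<close>
  obtain r where r: "r > 0" "ball (\<Phi> c) r \<subseteq> W"
    using W by (meson openE)
  define N where "N = U' \<inter> \<Phi> -` ball (\<Phi> c) r"
  have cont_\<Phi>: "continuous_on U' \<Phi>" and cont_h: "continuous_on W h"
    and h\<Phi>: "\<And>z. z \<in> U' \<Longrightarrow> h (\<Phi> z) = z" and \<Phi>h: "\<And>y. y \<in> W \<Longrightarrow> \<Phi> (h y) = y"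
    and h_in: "\<And>y. y \<in> W \<Longrightarrow> h y \<in> U'" and \<Phi>_in: "\<And>z. z \<in> U' \<Longrightarrow> \<Phi> z \<in> W"
    using hom by (auto simp: homeomorphism_def)
  have bij: "bij (blinfun_apply (\<Phi>' z))" if "z \<in> U'" for z
    using h'(3)[OF \<Phi>_in[OF that]] by (simp add: h\<Phi> that)
  have surj: "jointly_surjective I (g z)" if z: "z \<in> U'" for z
    unfolding jointly_surjective_def
  proof
    fix t
    obtain w where w: "blinfun_apply (\<Phi>' z) w = (\<Sum>i\<in>I. t i *\<^sub>R e i)"
      using bij[OF z] by (metis bij_is_surj surjD)
    have "\<forall>j\<in>I. w \<bullet> g z j = t j"
      using \<Phi>'_inner[of _ z w] by (simp add: w e_sum)
    then show "\<exists>w. \<forall>j\<in>I. w \<bullet> g z j = t j" ..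
  qed
  have "open N"
    unfolding N_def by (intro continuous_open_preimage cont_\<Phi> U') simp
  moreover have "c \<in> N" "N \<subseteq> \<Omega>"
    using U' r by (auto simp: N_def)
  moreover have "jointly_surjective I (g z)" if "z \<in> N" for z
    using that surj by (simp add: N_def)
  moreover have "f a = f b" if a: "a \<in> N" and b: "b \<in> N" and ab: "\<And>i. i \<in> I \<Longrightarrow> f a $ i = f b $ i" for a b
  proof -
    define u where "u = \<Phi> b - \<Phi> a"
    \<comment> \<open>Along this segment in the chart the selected components stay constant; by the
      rank bound the derivative of \<open>f\<close> in this direction is then zero.\<close>
    define \<gamma> where "\<gamma> s = \<Phi> a + s *\<^sub>R u" for s :: real
    have u0: "u \<bullet> g c j = 0" if "j \<in> I" for j
      using ab that by (simp add: u_def inner_diff_left \<Phi>_inner)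
    have \<gamma>: "\<gamma> s \<in> W" if "s \<in> {0..1}" for s
    proof -
      have "\<gamma> s = (1 - s) *\<^sub>R \<Phi> a + s *\<^sub>R \<Phi> b"
        by (simp add: \<gamma>_def u_def algebra_simps)
      also have "\<dots> \<in> ball (\<Phi> c) r"
        using convexD_alt[OF convex_ball, of "\<Phi> a" "\<Phi> c" r "\<Phi> b" s] a b that by (simp add: N_def)
      finally show ?thesis
        using r by blast
    qed
    have "((\<lambda>s. f (h (\<gamma> s))) has_derivative (\<lambda>_. 0)) (at s within {0..1})" if s: "s \<in> {0..1}" for s
    proof -
      let ?z = "h (\<gamma> s)"
      have z: "?z \<in> U'"
        using h_in[OF \<gamma>[OF s]] .
      have "(\<gamma> has_derivative (\<lambda>r. r *\<^sub>R u)) (at s within {0..1})"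
        unfolding \<gamma>_def by (auto intro!: derivative_eq_intros)
      then have "((\<lambda>s. h (\<gamma> s)) has_derivative (\<lambda>r. h' (\<gamma> s) (r *\<^sub>R u))) (at s within {0..1})"
        by (rule has_derivative_compose) (rule h'(1)[OF \<gamma>[OF s]])
      then have *: "((\<lambda>s. f (h (\<gamma> s))) has_derivative (\<lambda>r. \<chi> i. h' (\<gamma> s) (r *\<^sub>R u) \<bullet> g ?z i)) (at s within {0..1})"
        by (rule has_derivative_compose) (rule der, use z U' in blast)
      have "h' (\<gamma> s) (r *\<^sub>R u) \<bullet> g ?z k = 0" for r k
      proof (rule jointly_surjective_kernel[OF surj[OF z]])
        show "dim (span (range (g ?z))) \<le> card I"
          using rank z U' by blast
        have "blinfun_apply (\<Phi>' ?z) (h' (\<gamma> s) (r *\<^sub>R u)) = r *\<^sub>R u"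
          unfolding h'(2)[OF \<gamma>[OF s]] by (rule surj_f_inv_f[OF bij_is_surj[OF bij[OF z]]])
        then show "h' (\<gamma> s) (r *\<^sub>R u) \<bullet> g ?z j = 0" if "j \<in> I" for j
          using \<Phi>'_inner[OF that, of ?z "h' (\<gamma> s) (r *\<^sub>R u)"] u0[OF that] by simp
      qed
      then have "(\<lambda>r. \<chi> i. h' (\<gamma> s) (r *\<^sub>R u) \<bullet> g ?z i) = (\<lambda>_. 0)"
        by (simp add: fun_eq_iff vec_eq_iff)
      with * show ?thesis by simp
    qed
    then obtain k where k: "\<And>s. s \<in> {0..1} \<Longrightarrow> f (h (\<gamma> s)) = k"
      using has_derivative_zero_constant[of "{0..1::real}" "\<lambda>s. f (h (\<gamma> s))"] by auto
    have "f (h (\<gamma> 0)) = f (h (\<gamma> 1))"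
      using k[of 0] k[of 1] by simp
    then show ?thesis
      using a b by (simp add: \<gamma>_def u_def N_def h\<Phi>)
  qed
  \<comment> \<open>Openness of the image in the coordinates from \<open>I\<close>, expressed by a
    cylinder so as to remain in the same vector space.\<close>
  moreover have "open {y. \<exists>z\<in>M. \<forall>i\<in>I. y $ i = f z $ i}" if M: "open M" "M \<subseteq> N" for M
  proof (subst open_subopen, intro ballI)
    fix y0 assume "y0 \<in> {y. \<exists>z\<in>M. \<forall>i\<in>I. y $ i = f z $ i}"
    then obtain z0 where z0: "z0 \<in> M" "\<forall>i\<in>I. y0 $ i = f z0 $ i"
      by auto
    have MU: "M \<subseteq> U'"
      using M by (auto simp: N_def)
    \<comment> \<open>An affine section through \<open>\<Phi> z0\<close>: pulled back by
      \<open>h\<close>, the point \<open>\<kappa> y\<close> has the components of \<open>y\<close>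
      on \<open>I\<close>.\<close>
    define \<kappa> where "\<kappa> y = \<Phi> z0 + (\<Sum>i\<in>I. (y $ i - f z0 $ i) *\<^sub>R e i)" for y
    have "open (W \<inter> h -` M)"
      by (intro continuous_open_preimage cont_h W M)
    then have "open (\<kappa> -` (W \<inter> h -` M))"
      unfolding \<kappa>_def by (intro open_vimage continuous_intros) auto
    moreover have "y0 \<in> \<kappa> -` (W \<inter> h -` M)"
      using z0 MU \<Phi>_in h\<Phi> by (auto simp: \<kappa>_def)
    moreover have "\<exists>z\<in>M. \<forall>i\<in>I. y $ i = f z $ i" if "\<kappa> y \<in> W" "h (\<kappa> y) \<in> M" for y
    proof (intro bexI ballI)
      fix j assume j: "j \<in> I"
      have "f (h (\<kappa> y)) $ j = \<kappa> y \<bullet> g c j"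
        using \<Phi>_inner[OF j, of "h (\<kappa> y)"] by (simp add: \<Phi>h that)
      also have "\<dots> = y $ j"
        using j by (simp add: \<kappa>_def inner_add_left e_sum \<Phi>_inner)
      finally show "y $ j = f (h (\<kappa> y)) $ j" by simp
    qed fact
    ultimately show "\<exists>T. open T \<and> y0 \<in> T \<and> T \<subseteq> {y. \<exists>z\<in>M. \<forall>i\<in>I. y $ i = f z $ i}"
      by (intro exI[of _ "\<kappa> -` (W \<inter> h -` M)"]) auto
  qed
  ultimately show thesis
    by (rule that)
qed

section \<open>Charts and invariance of dimension\<close>

definition chart :: "nat \<Rightarrow> 'a::topological_space set \<Rightarrow> bool" where
  "chart d T \<longleftrightarrow> (\<exists>W. openin (Euclidean_space d) W \<and>
     top_of_set T homeomorphic_space subtopology (Euclidean_space d) W)"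

lemma chart_openin_subset:
  assumes "chart d T" and S: "openin (top_of_set T) S"
  shows "chart d S"
proof -
  obtain W p where W: "openin (Euclidean_space d) W"
    and p: "homeomorphic_map (top_of_set T) (subtopology (Euclidean_space d) W) p"
    using assms(1) unfolding chart_def homeomorphic_space by metis
  have S': "S \<subseteq> topspace (top_of_set T)"
    using openin_subset[OF S] .
  have pS: "openin (subtopology (Euclidean_space d) W) (p ` S)"
    using homeomorphic_map_openness[OF p S'] S by simp
  have open_pS: "openin (Euclidean_space d) (p ` S)"
    using openin_trans_full[OF pS W] .
  have "p ` S \<subseteq> W"
    using openin_imp_subset[OF pS] .
  have "homeomorphic_map (subtopology (top_of_set T) S)
      (subtopology (subtopology (Euclidean_space d) W) (p ` S)) p"
  proof (rule homeomorphic_map_subtopologies[OF p])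
    have "p ` S \<subseteq> topspace (subtopology (Euclidean_space d) W)"
      using pS by (rule openin_subset)
    then show "p ` (topspace (top_of_set T) \<inter> S) = topspace (subtopology (Euclidean_space d) W) \<inter> p ` S"
      using S' by (simp add: Int_absorb1 Int_absorb2)
  qed
  moreover have "subtopology (top_of_set T) S = top_of_set S"
    using S' by (simp add: subtopology_subtopology Int_absorb1)
  moreover have "subtopology (subtopology (Euclidean_space d) W) (p ` S) = subtopology (Euclidean_space d) (p ` S)"
    using \<open>p ` S \<subseteq> W\<close> by (simp add: subtopology_subtopology Int_absorb1)
  ultimately have "top_of_set S homeomorphic_space subtopology (Euclidean_space d) (p ` S)"
    using homeomorphic_map_imp_homeomorphic_space by metis
  then show ?thesis
    using open_pS unfolding chart_def by blast
qed

text \<open>\<open>Euclidean_space n\<close> consists of the sequences vanishing from index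
  \<open>n\<close> on. These spaces are nested, and varying the entry at \<open>m\<close> leaves the
  smaller one.\<close>

lemma not_openin_Euclidean_space_less:
  assumes "m < n" "W \<subseteq> topspace (Euclidean_space m)" "W \<noteq> {}"
  shows "\<not> openin (Euclidean_space n) W"
proof
  assume W: "openin (Euclidean_space n) W"
  obtain x where x: "x \<in> W"
    using assms(3) by blast
  then have x0: "x i = 0" if "i \<ge> m" for i
    using assms(2) that by (auto simp: topspace_Euclidean_space)
  define \<gamma> where "\<gamma> t = x(m := t)" for t :: real
  have "continuous_map euclideanreal (Euclidean_space n) \<gamma>"
    unfolding Euclidean_space_def continuous_map_in_subtopology continuous_map_componentwise_UNIV
  proof (intro conjI allI)
    show "continuous_map euclideanreal euclideanreal (\<lambda>t. \<gamma> t i)" for i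
      by (cases "i = m") (simp_all add: \<gamma>_def)
    show "\<gamma> \<in> topspace euclideanreal \<rightarrow> {x. \<forall>i\<ge>n. x i = 0}"
      using x0 assms(1) by (auto simp: \<gamma>_def)
  qed
  then have "openin euclideanreal {t \<in> topspace euclideanreal. \<gamma> t \<in> W}"
    using W by (rule openin_continuous_map_preimage)
  then have "open {t. \<gamma> t \<in> W}"
    by simp
  moreover have "\<gamma> 0 = x"
    using x0[of m] by (auto simp: \<gamma>_def)
  ultimately obtain \<epsilon> where \<epsilon>: "\<epsilon> > 0" "ball 0 \<epsilon> \<subseteq> {t. \<gamma> t \<in> W}"
    using x by (metis mem_Collect_eq openE)
  then have "\<gamma> (\<epsilon> / 2) \<in> W"
    by (auto simp: subset_iff dist_real_def)
  then have "\<gamma> (\<epsilon> / 2) m = 0"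
    using assms(2) by (auto simp: topspace_Euclidean_space)
  then show False
    using \<epsilon>(1) by (simp add: \<gamma>_def)
qed

text \<open>If \<open>d < d'\<close>, the change of charts maps an open set of the larger space
  injectively into the smaller one. Invariance of domain in the larger space would make that image
  open there. The empty set is excluded as it is a chart of every dimension.\<close>

lemma chart_dim_le:
  assumes "chart d T" "chart d' T" "T \<noteq> {}"
  shows "d' \<le> d"
proof (rule ccontr)
  assume "\<not> d' \<le> d"
  obtain W W' where W: "openin (Euclidean_space d) W"
      "top_of_set T homeomorphic_space subtopology (Euclidean_space d) W"
    and W': "openin (Euclidean_space d') W'"
      "top_of_set T homeomorphic_space subtopology (Euclidean_space d') W'"
    using assms(1,2) unfolding chart_def by metis
  have "subtopology (Euclidean_space d') W' homeomorphic_space subtopology (Euclidean_space d) W"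
    using W(2) W'(2) homeomorphic_space_sym homeomorphic_space_trans by blast
  then obtain p where p: "homeomorphic_map (subtopology (Euclidean_space d') W') (subtopology (Euclidean_space d) W) p"
    unfolding homeomorphic_space by metis
  have top: "topspace (subtopology (Euclidean_space d') W') = W'" "topspace (subtopology (Euclidean_space d) W) = W"
    using openin_subset[OF W(1)] openin_subset[OF W'(1)] by (simp_all add: Int_absorb1)
  have img: "p ` W' = W" and inj: "inj_on p W'"
    using homeomorphic_imp_surjective_map[OF p] homeomorphic_imp_injective_map[OF p] by (simp_all only: top)
  have "continuous_map (subtopology (Euclidean_space d') W') (subtopology (Euclidean_space d) W) p"
    by (rule homeomorphic_imp_continuous_map[OF p])
  then have "continuous_map (subtopology (Euclidean_space d') W') (Euclidean_space d) p"
    by (simp add: continuous_map_in_subtopology)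
  then have "continuous_map (subtopology (Euclidean_space d') W') (Euclidean_space d') p"
  proof -
    have "Euclidean_space d = subtopology (Euclidean_space d') (topspace (Euclidean_space d))"
      using \<open>\<not> d' \<le> d\<close>
      by (metis Euclidean_space_def inf.absorb_iff2 nat_le_linear subset_Euclidean_space
          subtopology_subtopology topspace_Euclidean_space)
    then show ?thesis
      using \<open>continuous_map (subtopology (Euclidean_space d') W') (Euclidean_space d) p\<close>
      by (metis continuous_map_in_subtopology)
  qed
  then have "openin (Euclidean_space d') W"
    using invariance_of_domain_Euclidean_space[OF W'(1) _ inj] img by simp
  moreover have "W \<noteq> {}"
  proof -
    obtain q where "homeomorphic_map (top_of_set T) (subtopology (Euclidean_space d) W) q"
      using W(2) unfolding homeomorphic_space by metis
    then have "q ` T = W"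
      using homeomorphic_imp_surjective_map top(2) by (metis topspace_euclidean_subtopology)
    then show ?thesis
      using assms(3) by auto
  qed
  ultimately show False
    using not_openin_Euclidean_space_less[of d d' W] openin_subset[OF W(1)] \<open>\<not> d' \<le> d\<close> by simp
qed

lemma manifold_of_dim_top_of_set_iff:
  fixes U :: "'a::{metric_space,second_countable_topology} set"
  shows "manifold_of_dim d (top_of_set U) \<longleftrightarrow>
    (\<forall>x\<in>U. \<exists>N. openin (top_of_set U) N \<and> x \<in> N \<and> chart d N)"
proof -
  have sub: "subtopology (top_of_set U) N = top_of_set N" if "openin (top_of_set U) N" for N
    using openin_imp_subset[OF that] by (simp add: subtopology_subtopology Int_absorb1)
  have "second_countable (euclidean :: 'a topology)"
  proof -
    obtain \<B> :: "'a set set" where \<B>: "countable \<B>" "topological_basis \<B>"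
      using ex_countable_basis by blast
    then show ?thesis
      unfolding second_countable_def
    proof (intro exI[of _ \<B>] conjI ballI allI impI)
      show "openin euclidean V" if "V \<in> \<B>" for V
        using topological_basis_open[OF \<B>(2) that] by simp
      show "\<exists>V\<in>\<B>. x \<in> V \<and> V \<subseteq> U" if "openin euclidean U \<and> x \<in> U" for U x
        using topological_basisE[OF \<B>(2), of U x] that by (metis open_openin)
    qed (rule \<B>(1))
  qed
  then have "second_countable (top_of_set U)" "Hausdorff_space (top_of_set U)"
    by (simp_all add: second_countable_subtopology Hausdorff_space_subtopology)
  then have "manifold_of_dim d (top_of_set U) \<longleftrightarrow>
    (\<forall>x\<in>U. \<exists>N W. openin (top_of_set U) N \<and> x \<in> N \<and> openin (Euclidean_space d) W \<and>
      subtopology (top_of_set U) N homeomorphic_space subtopology (Euclidean_space d) W)"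
    by (simp add: manifold_of_dim_def)
  also have "\<dots> \<longleftrightarrow> (\<forall>x\<in>U. \<exists>N. openin (top_of_set U) N \<and> x \<in> N \<and> chart d N)"
    unfolding chart_def by (intro ball_cong ex_cong1 refl) (auto simp: sub)
  finally show ?thesis .
qed

text \<open>The union of all open charts is a dense manifold. Any competing dense manifold contains
  a nonempty open chart of its own dimension, inside which \<open>dense\<close> finds one of
  dimension \<open>d\<close>; invariance of dimension compares the two.\<close>

lemma real_dim_eqI:
  fixes A :: "(real ^ 'n) set"
  assumes A: "A \<noteq> {}"
    and dense: "\<And>S. openin (top_of_set A) S \<Longrightarrow> S \<noteq> {} \<Longrightarrow>
      \<exists>T\<subseteq>S. T \<noteq> {} \<and> openin (top_of_set A) T \<and> chart d T"
  shows "real_dim A = d"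
proof -
  define R where "R d \<longleftrightarrow> (\<exists>U. openin (top_of_set A) U \<and> top_of_set A closure_of U = A \<and>
    manifold_of_dim d (top_of_set U))" for d
  define U where "U = \<Union>{T. openin (top_of_set A) T \<and> chart d T}"
  have U: "openin (top_of_set A) U"
    unfolding U_def by (rule openin_Union) auto
  have "A \<subseteq> top_of_set A closure_of U"
  proof
    fix x assume x: "x \<in> A"
    have "\<exists>y. y \<in> U \<and> y \<in> S" if S: "x \<in> S \<and> openin (top_of_set A) S" for S
    proof -
      obtain T where "T \<subseteq> S" "T \<noteq> {}" "openin (top_of_set A) T" "chart d T"
        using dense[of S] S by blast
      then show ?thesis
        unfolding U_def by blast
    qed
    then show "x \<in> top_of_set A closure_of U"
      using x by (simp add: in_closure_of)
  qed
  then have "top_of_set A closure_of U = A"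
    using closure_of_subset_topspace[of "top_of_set A" U] by simp
  moreover have "manifold_of_dim d (top_of_set U)"
    unfolding manifold_of_dim_top_of_set_iff
  proof
    fix x assume "x \<in> U"
    then obtain T where T: "openin (top_of_set A) T" "chart d T" "x \<in> T"
      unfolding U_def by blast
    then have "T \<subseteq> U"
      unfolding U_def by blast
    then have "openin (top_of_set U) T"
      using openin_subset_trans[OF T(1)] openin_imp_subset[OF U] by blast
    with T show "\<exists>N. openin (top_of_set U) N \<and> x \<in> N \<and> chart d N"
      by blast
  qed
  ultimately have "R d"
    using U unfolding R_def by blast
  moreover have "d' = d" if R: "R d'" for d'
  proof -
    obtain U' where U': "openin (top_of_set A) U'" "top_of_set A closure_of U' = A"
      "manifold_of_dim d' (top_of_set U')"
      using R unfolding R_def by metis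
    have "U' \<noteq> {}"
      using U'(2) A by auto
    then obtain N where N: "openin (top_of_set U') N" "N \<noteq> {}" "chart d' N"
      using U'(3) unfolding manifold_of_dim_top_of_set_iff by (metis empty_iff ex_in_conv)
    have NA: "openin (top_of_set A) N"
      using openin_trans[OF N(1) U'(1)] .
    then obtain T where T: "T \<subseteq> N" "T \<noteq> {}" "openin (top_of_set A) T" "chart d T"
      using dense N(2) by blast
    have "openin (top_of_set N) T"
      using openin_subset_trans[OF T(3,1)] openin_imp_subset[OF NA] by blast
    then have "chart d' T"
      using chart_openin_subset N(3) by blast
    then show ?thesis
      using chart_dim_le T(2,4) by (metis antisym)
  qed
  ultimately have "(THE d. R d) = d"
    by (rule the_equality)
  then show ?thesis
    by (simp add: real_dim_def R_def)
qed

lemma chart_coordinate_subspace: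
  fixes T :: "(real ^ 'n) set"
  assumes "openin (top_of_set {x. \<forall>i. i \<notin> I \<longrightarrow> x $ i = 0}) T"
  shows "chart (card I) T"
proof (rule chart_openin_subset)
  let ?E = "{x :: real ^ 'n. \<forall>i. i \<notin> I \<longrightarrow> x $ i = 0}"
  have "subspace ?E"
    by (simp add: subspace_def)
  moreover have "dim ?E = card I"
  proof -
    have E: "?E = {x. \<forall>b\<in>Basis. b \<notin> (\<lambda>i. axis i 1) ` I \<longrightarrow> x \<bullet> b = 0}"
      by (auto simp: Basis_vec_def inner_axis axis_eq_axis)
    have "(\<lambda>i. axis i 1 :: real ^ 'n) ` I \<subseteq> Basis"
      by (auto simp: Basis_vec_def)
    then have "dim ?E = card ((\<lambda>i. axis i 1 :: real ^ 'n) ` I)"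
      unfolding E by (rule dim_substandard)
    also have "\<dots> = card I"
      by (intro card_image inj_onI) (simp add: axis_eq_axis)
    finally show ?thesis .
  qed
  ultimately have "top_of_set ?E homeomorphic_space Euclidean_space (card I)"
    by (simp add: homeomorphic_subspace_Euclidean_space)
  then show "chart (card I) ?E"
    unfolding chart_def by (intro exI[of _ "topspace (Euclidean_space (card I))"]) simp
qed fact

lemma chart_homeomorphic: "S homeomorphic T \<Longrightarrow> chart d T \<Longrightarrow> chart d S"
  unfolding chart_def homeomorphic_space_iff_homeomorphic[symmetric]
  using homeomorphic_space_trans by blast

text \<open>By the constant rank theorem, \<open>S\<close> is covered by countably many compact graphs over the
  coordinates in \<open>I\<close>; one of them has interior in the closed set \<open>f ` \<Omega>\<close> by Baire.\<close>

lemma ex_chart_in_image: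
  fixes f :: "'a::euclidean_space \<Rightarrow> real ^ 'n" and g :: "'a \<Rightarrow> 'n \<Rightarrow> 'a"
  assumes \<Omega>: "open \<Omega>"
    and der: "\<And>z. z \<in> \<Omega> \<Longrightarrow> (f has_derivative (\<lambda>v. \<chi> i. v \<bullet> g z i)) (at z)"
    and cont: "\<And>i. continuous_on \<Omega> (\<lambda>z. g z i)"
    and rank: "\<And>z. z \<in> \<Omega> \<Longrightarrow> dim (span (range (g z))) \<le> card I"
    and closed: "closed (f ` \<Omega>)"
    and S: "openin (top_of_set (f ` \<Omega>)) S" "S \<noteq> {}"
    and reg: "\<And>z. z \<in> \<Omega> \<Longrightarrow> f z \<in> S \<Longrightarrow> jointly_surjective I (g z)"
  shows "\<exists>T\<subseteq>S. T \<noteq> {} \<and> openin (top_of_set (f ` \<Omega>)) T \<and> chart (card I) T"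
proof -
  let ?A = "f ` \<Omega>"
  have cont_f: "continuous_on \<Omega> f"
    by (intro continuous_at_imp_continuous_on ballI has_derivative_continuous[OF der])
  have open_pre: "open (\<Omega> \<inter> f -` T)" if T: "openin (top_of_set ?A) T" for T
  proof -
    obtain O' where "open O'" "T = ?A \<inter> O'"
      using T unfolding openin_open by metis
    then have "\<Omega> \<inter> f -` T = \<Omega> \<inter> f -` O'"
      by auto
    then show ?thesis
      using continuous_open_preimage[OF cont_f \<Omega> \<open>open O'\<close>] by simp
  qed
  define M where "M = \<Omega> \<inter> f -` S"
  have M: "open M" "M \<subseteq> \<Omega>"
    using open_pre[OF S(1)] by (auto simp: M_def)
  have fM: "f ` M = S"
    using openin_imp_subset[OF S(1)] by (auto simp: M_def)
  define nice where "nice c N \<longleftrightarrow> open N \<and> c \<in> N \<and> N \<subseteq> M \<and>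
      (\<forall>a\<in>N. \<forall>b\<in>N. (\<forall>i\<in>I. f a $ i = f b $ i) \<longrightarrow> f a = f b) \<and>
      (\<forall>M'. open M' \<longrightarrow> M' \<subseteq> N \<longrightarrow> open {y. \<exists>z\<in>M'. \<forall>i\<in>I. y $ i = f z $ i})" for c N
  have "\<exists>N. nice c N" if c: "c \<in> M" for c
  proof -
    have cont': "continuous_on M (\<lambda>z. g z i)" for i
      using cont M(2) by (rule continuous_on_subset)
    have reg': "jointly_surjective I (g c)"
      using c reg by (simp add: M_def)
    obtain N where "open N" "c \<in> N" "N \<subseteq> M"
      "\<And>a b. a \<in> N \<Longrightarrow> b \<in> N \<Longrightarrow> (\<And>i. i \<in> I \<Longrightarrow> f a $ i = f b $ i) \<Longrightarrow> f a = f b"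
      "\<And>M'. open M' \<Longrightarrow> M' \<subseteq> N \<Longrightarrow> open {y. \<exists>z\<in>M'. \<forall>i\<in>I. y $ i = f z $ i}"
      by (rule constant_rank[OF M(1) der cont' rank c reg']) (use M(2) in auto)
    then have "nice c N"
      by (simp add: nice_def)
    then show ?thesis ..
  qed
  then obtain N where nice: "\<And>c. c \<in> M \<Longrightarrow> nice c (N c)"
    by metis
  have N: "open (N c)" "c \<in> N c" "N c \<subseteq> M"
    "\<And>a b. a \<in> N c \<Longrightarrow> b \<in> N c \<Longrightarrow> \<forall>i\<in>I. f a $ i = f b $ i \<Longrightarrow> f a = f b"
    "\<And>M'. open M' \<Longrightarrow> M' \<subseteq> N c \<Longrightarrow> open {y. \<exists>z\<in>M'. \<forall>i\<in>I. y $ i = f z $ i}"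
    if "c \<in> M" for c
    using nice[OF that] by (simp_all add: nice_def)
  have "\<exists>r>0. cball c r \<subseteq> N c" if "c \<in> M" for c
    using N(1,2)[OF that] by (meson open_contains_cball)
  then obtain r where r: "\<And>c. c \<in> M \<Longrightarrow> r c > 0" "\<And>c. c \<in> M \<Longrightarrow> cball c (r c) \<subseteq> N c"
    by metis
  obtain \<F> where \<F>: "\<F> \<subseteq> (\<lambda>c. ball c (r c)) ` M" "countable \<F>" "\<Union>\<F> = (\<Union>c\<in>M. ball c (r c))"
    by (rule Lindelof[of "(\<lambda>c. ball c (r c)) ` M"]) auto
  then obtain C where C: "C \<subseteq> M" "countable C" "\<F> = (\<lambda>c. ball c (r c)) ` C"
    using countable_subset_image[of \<F> "\<lambda>c. ball c (r c)" M] by metis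
  \<comment> \<open>Images of closed balls are compact, so the injective coordinate projection is
    automatically a homeomorphism on them.\<close>
  define Kc where "Kc c = f ` cball c (r c)" for c
  have KcS: "Kc c \<subseteq> S" if "c \<in> M" for c
    using r(2)[OF that] N(3)[OF that] fM by (auto simp: Kc_def)
  have compact_Kc: "compact (Kc c)" if "c \<in> M" for c
    unfolding Kc_def using r(2)[OF that] N(3)[OF that] M(2)
    by (intro compact_continuous_image continuous_on_subset[OF cont_f]) auto
  have cover: "S \<subseteq> (\<Union>c\<in>C. Kc c)"
  proof
    fix y assume "y \<in> S"
    then obtain z where z: "z \<in> M" "y = f z"
      using fM by auto
    have "z \<in> ball z (r z)"
      using r(1)[OF z(1)] by simp
    then have "z \<in> \<Union>\<F>"
      unfolding \<F>(3) using z(1) by (rule UN_I[rotated])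
    then obtain c where "c \<in> C" "z \<in> ball c (r c)"
      using C(3) by auto
    then have "y \<in> Kc c"
      unfolding Kc_def z(2) by (intro imageI) simp
    with \<open>c \<in> C\<close> show "y \<in> (\<Union>c\<in>C. Kc c)"
      by blast
  qed
  have "\<exists>c\<in>C. \<exists>T. openin (top_of_set ?A) T \<and> T \<noteq> {} \<and> T \<subseteq> Kc c"
  proof (rule ccontr)
    assume none: "\<not> (\<exists>c\<in>C. \<exists>T. openin (top_of_set ?A) T \<and> T \<noteq> {} \<and> T \<subseteq> Kc c)"
    have "?A \<subseteq> closure (\<Inter>((\<lambda>c. ?A - Kc c) ` C))"
    proof (rule Baire[OF closed])
      show "countable ((\<lambda>c. ?A - Kc c) ` C)"
        using C(2) by simp
      fix T assume "T \<in> (\<lambda>c. ?A - Kc c) ` C"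
      then obtain c where c: "c \<in> C" "T = ?A - Kc c"
        by auto
      have "closed (Kc c)"
        using compact_Kc c(1) C(1) by (blast intro: compact_imp_closed)
      then have "openin (top_of_set ?A) (?A \<inter> (- Kc c))"
        by (intro openin_open_Int) auto
      then have "openin (top_of_set ?A) T"
        by (simp add: c(2) Diff_eq)
      moreover have "?A \<subseteq> closure T"
      proof (rule ccontr)
        assume "\<not> ?A \<subseteq> closure T"
        then have "?A \<inter> (- closure T) \<noteq> {}"
          by blast
        moreover have "openin (top_of_set ?A) (?A \<inter> (- closure T))"
          by (intro openin_open_Int) auto
        moreover have "?A \<inter> (- closure T) \<subseteq> Kc c"
          using closure_subset[of T] c(2) by blast
        ultimately show False
          using none c(1) by blast
      qed
      ultimately show "openin (top_of_set ?A) T \<and> ?A \<subseteq> closure T" ..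
    qed
    moreover obtain x where x: "x \<in> S"
      using S(2) by blast
    moreover obtain O' where O': "open O'" "S = ?A \<inter> O'"
      using S(1) unfolding openin_open by metis
    ultimately have "O' \<inter> \<Inter>((\<lambda>c. ?A - Kc c) ` C) \<noteq> {}"
      using open_Int_closure_eq_empty[OF O'(1)] by blast
    then obtain y where y: "y \<in> O'" and "y \<in> \<Inter>((\<lambda>c. ?A - Kc c) ` C)"
      by (metis IntE ex_in_conv)
    from this(2) have yA: "y \<in> ?A - Kc c" if "c \<in> C" for c
      using INT_D[OF _ that, of y "\<lambda>c. ?A - Kc c"] by simp
    have "C \<noteq> {}"
      using cover S(2) by auto
    then have "y \<in> S"
      using y yA O'(2) by auto
    then show False
      using cover yA by auto
  qed
  then obtain c T where T: "c \<in> C" "openin (top_of_set ?A) T" "T \<noteq> {}" "T \<subseteq> Kc c"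
    by blast
  have cM: "c \<in> M"
    using T(1) C(1) by blast
  have TS: "T \<subseteq> S"
    using T(4) KcS[OF cM] by blast
  \<comment> \<open>The coordinates outside \<open>I\<close> are set to 0 rather than dropped, so
    the target is a coordinate subspace of the same type.\<close>
  define \<pi> where "\<pi> x = (\<chi> i. if i \<in> I then x $ i else 0)" for x :: "real ^ 'n"
  have cont_\<pi>: "continuous_on X \<pi>" for X
    unfolding \<pi>_def
  proof (rule continuous_on_vec_lambda)
    show "continuous_on X (\<lambda>x. if i \<in> I then x $ i else 0)" for i
      by (cases "i \<in> I") (simp_all add: continuous_on_component)
  qed
  have \<pi>_eq: "\<pi> x = \<pi> y \<longleftrightarrow> (\<forall>i\<in>I. x $ i = y $ i)" for x y
    by (auto simp: \<pi>_def vec_eq_iff)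
  have "inj_on \<pi> (Kc c)"
  proof (rule inj_onI)
    fix x y assume "x \<in> Kc c" "y \<in> Kc c" "\<pi> x = \<pi> y"
    then obtain a b where "a \<in> N c" "b \<in> N c" "x = f a" "y = f b"
      using r(2)[OF cM] unfolding Kc_def by blast
    then show "x = y"
      using N(4)[OF cM] \<open>\<pi> x = \<pi> y\<close> \<pi>_eq by blast
  qed
  then obtain \<rho> where "homeomorphism (Kc c) (\<pi> ` Kc c) \<pi> \<rho>"
    using homeomorphism_compact[OF compact_Kc[OF cM] cont_\<pi>] by blast
  then have "homeomorphism T (\<pi> ` T) \<pi> \<rho>"
    by (rule homeomorphism_of_subsets) (use T(4) in auto)
  then have "T homeomorphic \<pi> ` T"
    unfolding homeomorphic_def by blast
  moreover have "openin (top_of_set {x. \<forall>i. i \<notin> I \<longrightarrow> x $ i = 0}) (\<pi> ` T)"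
  proof -
    \<comment> \<open>The entire preimage of \<open>T\<close> is used, not only its part near
      \<open>c\<close>. It is open, so it meets each neighbourhood in an open piece whose
      \<open>I\<close>-coordinates form an open set.\<close>
    let ?M = "\<Omega> \<inter> f -` T"
    have subM: "?M \<subseteq> M"
      using TS by (auto simp: M_def)
    define Y where "Y = {y. \<exists>z\<in>?M. \<forall>i\<in>I. y $ i = f z $ i}"
    have "Y = (\<Union>c\<in>M. {y. \<exists>z\<in>?M \<inter> N c. \<forall>i\<in>I. y $ i = f z $ i})"
      unfolding Y_def using subM N(2) by blast
    moreover have "open {y. \<exists>z\<in>?M \<inter> N c. \<forall>i\<in>I. y $ i = f z $ i}" if "c \<in> M" for c
      by (rule N(5)[OF that open_Int[OF open_pre[OF T(2)] N(1)[OF that]]]) simp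
    ultimately have "open Y"
      by auto
    moreover have "\<pi> ` T = {x. \<forall>i. i \<notin> I \<longrightarrow> x $ i = 0} \<inter> Y"
    proof
      show "\<pi> ` T \<subseteq> {x. \<forall>i. i \<notin> I \<longrightarrow> x $ i = 0} \<inter> Y"
      proof
        fix x assume "x \<in> \<pi> ` T"
        then obtain t where t: "t \<in> T" "x = \<pi> t"
          by blast
        then obtain z where "z \<in> \<Omega>" "t = f z"
          using openin_imp_subset[OF T(2)] by blast
        then have "x \<in> Y"
          using t unfolding Y_def by (auto simp: \<pi>_def)
        then show "x \<in> {x. \<forall>i. i \<notin> I \<longrightarrow> x $ i = 0} \<inter> Y"
          using t(2) by (simp add: \<pi>_def)
      qed
      show "{x. \<forall>i. i \<notin> I \<longrightarrow> x $ i = 0} \<inter> Y \<subseteq> \<pi> ` T"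
      proof
        fix x assume x: "x \<in> {x. \<forall>i. i \<notin> I \<longrightarrow> x $ i = 0} \<inter> Y"
        then obtain z where z: "f z \<in> T" "\<forall>i\<in>I. x $ i = f z $ i"
          by (auto simp: Y_def)
        then have "x = \<pi> (f z)"
          using x by (simp add: \<pi>_def vec_eq_iff)
        then show "x \<in> \<pi> ` T"
          using z(1) by blast
      qed
    qed
    ultimately show ?thesis
      by (simp add: openin_open_Int)
  qed
  ultimately have "chart (card I) T"
    using chart_homeomorphic chart_coordinate_subspace by blast
  then show ?thesis
    using T TS by blast
qed

section \<open>The amoeba of a linear space\<close>

text \<open>\<open>Log\<close> is proper on the torus: a bounded sequence of logarithms keeps the
  coordinates bounded, and in the limit their moduli are exponentials and hence nonzero.\<close>

lemma closed_Log_image: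
  fixes S :: "(complex ^ 'n) set"
  assumes "closed S"
  shows "closed (Log ` (S \<inter> torus))"
  unfolding closed_sequential_limits
proof (intro allI impI)
  fix x l assume "(\<forall>n. x n \<in> Log ` (S \<inter> torus)) \<and> x \<longlonglongrightarrow> l"
  then have "\<forall>n. \<exists>z. z \<in> S \<and> z \<in> torus \<and> x n = Log z" and x: "x \<longlonglongrightarrow> l"
    by auto
  then obtain z where z: "\<And>n. z n \<in> S" "\<And>n. z n \<in> torus" "\<And>n. x n = Log (z n)"
    by metis
  have exp_x: "exp (x n $ i) = cmod (z n $ i)" for n i
    using z(2)[of n] by (simp add: z(3) Log_def torus_def)
  obtain b where b: "\<And>n. norm (x n) \<le> b"
    using x by (metis convergent_imp_Bseq BseqE convergentI)
  have "norm (z n) \<le> real CARD('n) * exp b" for n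
  proof -
    have "cmod (z n $ i) \<le> exp b" for i
      using order_trans[OF component_le_norm_cart b, of n i] by (simp flip: exp_x)
    then have "(\<Sum>i\<in>UNIV. cmod (z n $ i)) \<le> (\<Sum>i\<in>(UNIV::'n set). exp b)"
      by (intro sum_mono)
    then show ?thesis
      using order_trans[OF L2_set_le_sum, of UNIV "\<lambda>i. cmod (z n $ i)"] by (simp add: norm_vec_def)
  qed
  then have "bounded (range z)"
    by (auto simp: bounded_iff)
  then obtain z0 r where r: "strict_mono r" "(z \<circ> r) \<longlonglongrightarrow> z0"
    using bounded_imp_convergent_subsequence by metis
  have z0: "z0 \<in> S"
    using closed_sequentially[OF assms, of "z \<circ> r"] r(2) z(1) by simp
  have cmod_z0: "cmod (z0 $ i) = exp (l $ i)" for i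
  proof (rule LIMSEQ_unique)
    show "(\<lambda>n. cmod ((z \<circ> r) n $ i)) \<longlonglongrightarrow> cmod (z0 $ i)"
      by (intro tendsto_norm tendsto_vec_nth r)
    have "(\<lambda>n. exp ((x \<circ> r) n $ i)) \<longlonglongrightarrow> exp (l $ i)"
      using LIMSEQ_subseq_LIMSEQ[OF x r(1)] by (intro tendsto_exp tendsto_vec_nth)
    then show "(\<lambda>n. cmod ((z \<circ> r) n $ i)) \<longlonglongrightarrow> exp (l $ i)"
      by (simp add: exp_x)
  qed
  have "z0 $ i \<noteq> 0" for i
    using cmod_z0[of i] by (metis exp_not_eq_zero norm_zero)
  then have "z0 \<in> torus"
    by (simp add: torus_def)
  moreover have "Log z0 = l"
    by (simp add: Log_def vec_eq_iff cmod_z0)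
  ultimately show "l \<in> Log ` (S \<inter> torus)"
    using z0 by auto
qed

section \<open>The logarithm map on an ambient open set and its regular points\<close>

context linear_amoeba
begin

text \<open>Composing with \<open>P\<close> extends \<open>Log\<close> from \<open>V\<close> to an
  open set of the ambient space, where the inverse function theorem applies directly; the image is
  still the amoeba.\<close>

definition \<Omega> :: "(complex ^ 'n) set" where "\<Omega> = {z. P z \<in> torus}"

definition Log_P :: "complex ^ 'n \<Rightarrow> real ^ 'n" where "Log_P z = Log (P z)"

definition grad_Log :: "complex ^ 'n \<Rightarrow> 'n \<Rightarrow> complex ^ 'n" where
  "grad_Log z i = inverse ((cmod (P z $ i))\<^sup>2) *\<^sub>R grad (P z) i"

text \<open>The subtraction is that of natural numbers; it is never truncated here, since nonempty
  blocks have positive rank.\<close>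

definition min_sum :: nat where
  "min_sum = Min ((\<lambda>Q. \<Sum>B\<in>Q. 2 * proj_rank V B - 1) ` {Q. partition_on UNIV Q})"

lemma bounded_linear_P: "bounded_linear P"
  using P_linear linear_conv_bounded_linear by blast

lemma bounded_linear_P_nth: "bounded_linear (\<lambda>z. P z $ i)"
  using bounded_linear_compose[OF bounded_linear_vec_nth bounded_linear_P] by simp

lemma open_\<Omega>: "open \<Omega>"
proof -
  have "\<Omega> = (\<Inter>i. {z. P z $ i \<noteq> 0})"
    by (auto simp: \<Omega>_def torus_def)
  moreover have "open {z. P z $ i \<noteq> 0}" for i
    by (intro open_Collect_neq linear_continuous_on bounded_linear_P_nth continuous_on_const)
  ultimately show ?thesis
    by auto
qed

lemma Log_P_image: "Log_P ` \<Omega> = Log ` (V \<inter> torus)"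
proof
  show "Log_P ` \<Omega> \<subseteq> Log ` (V \<inter> torus)"
    using P_in by (auto simp: Log_P_def \<Omega>_def)
  show "Log ` (V \<inter> torus) \<subseteq> Log_P ` \<Omega>"
  proof
    fix x assume "x \<in> Log ` (V \<inter> torus)"
    then obtain y where "y \<in> V" "y \<in> torus" "x = Log y"
      by auto
    then show "x \<in> Log_P ` \<Omega>"
      by (intro image_eqI[of _ _ y]) (simp_all add: Log_P_def \<Omega>_def P_id)
  qed
qed

lemma Log_P_has_derivative:
  assumes z: "z \<in> \<Omega>"
  shows "(Log_P has_derivative (\<lambda>v. \<chi> i. v \<bullet> grad_Log z i)) (at z)"
  unfolding has_derivative_componentwise_within[of Log_P]
proof
  fix b :: "real ^ 'n" assume "b \<in> Basis"
  then obtain i where b: "b = axis i 1"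
    by (auto simp: Basis_vec_def)
  have nz: "P z $ i \<noteq> 0"
    using z by (simp add: \<Omega>_def torus_def)
  have "((\<lambda>x. cmod (P x $ i)) has_derivative (\<lambda>v. P v $ i \<bullet> sgn (P z $ i))) (at z)"
    using has_derivative_compose[OF bounded_linear_imp_has_derivative[OF bounded_linear_P_nth]
        has_derivative_norm[OF nz]] .
  then have "((\<lambda>x. ln (cmod (P x $ i))) has_derivative
      (\<lambda>v. P v $ i \<bullet> sgn (P z $ i) * inverse (cmod (P z $ i)))) (at z)"
    by (rule has_derivative_ln[rotated]) (simp add: nz)
  \<comment> \<open>One inverse modulus comes from \<open>sgn\<close>, the other from the derivative
    of \<open>ln\<close>.\<close>
  moreover have "P v $ i \<bullet> sgn (P z $ i) * inverse (cmod (P z $ i)) = v \<bullet> grad_Log z i" for v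
    by (simp add: grad_Log_def grad_def inner_commute[of v] inner_P_axis inner_commute[of "P v $ i"]
        sgn_div_norm power2_eq_square)
  ultimately show "((\<lambda>x. Log_P x \<bullet> b) has_derivative (\<lambda>v. (\<chi> i. v \<bullet> grad_Log z i) \<bullet> b)) (at z)"
    by (simp add: b inner_axis Log_P_def Log_def)
qed

lemma continuous_on_grad_Log: "continuous_on \<Omega> (\<lambda>z. grad_Log z i)"
  unfolding grad_Log_def
proof (intro continuous_on_scaleR continuous_on_inverse continuous_on_power continuous_on_norm)
  show "continuous_on \<Omega> (\<lambda>z. P z $ i)"
    by (intro linear_continuous_on bounded_linear_P_nth)
  have "linear (\<lambda>z. grad (P z) i)"
  proof -
    have "linear (axis i :: complex \<Rightarrow> complex ^ 'n)"
      by (rule linearI) (auto simp: axis_def vec_eq_iff)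
    then show ?thesis
      using linear_compose[OF linear_compose[OF bounded_linear.linear[OF bounded_linear_P_nth, of i]] P_linear]
      by (simp add: grad_def o_def)
  qed
  then show "continuous_on \<Omega> (\<lambda>z. grad (P z) i)"
    by (intro linear_continuous_on) (simp add: linear_conv_bounded_linear)
  show "\<forall>z\<in>\<Omega>. (cmod (P z $ i))\<^sup>2 \<noteq> 0"
    by (simp add: \<Omega>_def torus_def)
qed

lemma min_sum_le: "partition_on UNIV Q \<Longrightarrow> min_sum \<le> (\<Sum>B\<in>Q. 2 * proj_rank V B - 1)"
  unfolding min_sum_def by (intro Min_le) (auto intro: finitely_many_partition_on)

lemma dim_grad_le_min_sum:
  assumes "y \<in> V" "y \<in> torus"
  shows "dim (span (range (grad y))) \<le> min_sum"
proof -
  have "min_sum \<in> (\<lambda>Q. \<Sum>B\<in>Q. 2 * proj_rank V B - 1) ` {Q. partition_on UNIV Q}"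
    unfolding min_sum_def
    by (rule Min_in) (auto intro: finitely_many_partition_on exI[of _ "{UNIV}"] partition_on_space)
  then show ?thesis
    using dim_grad_le[OF assms] by auto
qed

lemma dim_grad_Log_le: "z \<in> \<Omega> \<Longrightarrow> dim (span (range (grad_Log z))) \<le> min_sum"
proof -
  assume z: "z \<in> \<Omega>"
  have "span (range (grad_Log z)) \<subseteq> span (range (grad (P z)))"
    by (rule span_minimal) (auto simp: grad_Log_def intro: span_scale span_base)
  then have "dim (span (range (grad_Log z))) \<le> dim (span (range (grad (P z))))"
    by (rule dim_subset)
  also have "\<dots> \<le> min_sum"
    using z P_in by (intro dim_grad_le_min_sum) (auto simp: \<Omega>_def)
  finally show ?thesis .
qed

lemma jointly_surjective_grad_Log:
  assumes "z \<in> \<Omega>" "jointly_surjective I (grad (P z))"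
  shows "jointly_surjective I (grad_Log z)"
  unfolding grad_Log_def using assms
  by (intro jointly_surjective_scale) (auto simp: \<Omega>_def torus_def)

text \<open>Differentiating the identities \<open>q $ i = (cmod (y $ i))\<^sup>2\<close> along suitable derivations realises
  every prescribed value of the functionals \<open>grad y i\<close> by a vector of \<open>V\<close>.\<close>

lemma jointly_surjective_grad_generic_fibre:
  fixes q :: "real ^ 'n"
  assumes q: "\<And>w. \<exists>D. derivation_on UNIV D \<and> (\<forall>y\<in>K. D y = 0) \<and> dmap D q = w"
    and y: "y \<in> V" "\<And>i. i \<in> I \<Longrightarrow> q $ i = (cmod (y $ i))\<^sup>2"
  shows "jointly_surjective I (grad y)"
  unfolding jointly_surjective_def
proof
  fix t :: "'n \<Rightarrow> real"
  \<comment> \<open>The factor 2 matches the derivative of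
    \<open>y $ i \<bullet> y $ i\<close>.\<close>
  obtain D where D: "derivation_on UNIV D" "\<forall>y\<in>K. D y = 0" "dmap D q = (\<chi> i. 2 * t i)"
    using q by metis
  have P: "P (dmap D y) = dmap D y"
    using P_dmap[OF D(1), of y] D(2) P_id[OF y(1)] by simp
  have "dmap D y \<bullet> grad y i = t i" if "i \<in> I" for i
  proof -
    have "D (q $ i) = 2 * t i"
      using D(3) dmap_nth[of D q i] by (simp add: dmap_def)
    moreover have "q $ i = y $ i \<bullet> y $ i"
      by (simp add: y(2)[OF that] power2_norm_eq_inner)
    moreover have "dmap D y \<bullet> grad y i = y $ i \<bullet> dmap D (y $ i)"
      by (simp add: grad_def inner_commute[of "dmap D y"] inner_P_axis P dmap_nth)
    ultimately show ?thesis
      using dmap_inner[OF D(1), of "y $ i" "y $ i"] by (simp add: inner_commute)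
  qed
  then show "\<exists>w. \<forall>i\<in>I. w \<bullet> grad y i = t i"
    by blast
qed

text \<open>Where the rank is maximal, the constant rank theorem supplies a neighbourhood of regular
  points.\<close>

lemma open_regular: 
  assumes "card I = min_sum"
  shows "open {z \<in> \<Omega>. jointly_surjective I (grad_Log z)}"
proof (subst open_subopen, intro ballI)
  fix c assume "c \<in> {z \<in> \<Omega>. jointly_surjective I (grad_Log z)}"
  then have c: "c \<in> \<Omega>" "jointly_surjective I (grad_Log c)"
    by auto
  have rank: "dim (span (range (grad_Log z))) \<le> card I" if "z \<in> \<Omega>" for z
    using dim_grad_Log_le[OF that] assms by simp
  show "\<exists>T. open T \<and> c \<in> T \<and> T \<subseteq> {z \<in> \<Omega>. jointly_surjective I (grad_Log z)}"
  proof (rule constant_rank[OF open_\<Omega> Log_P_has_derivative continuous_on_grad_Log rank c])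
    fix N assume "open N" "c \<in> N" "N \<subseteq> \<Omega>" "\<And>z. z \<in> N \<Longrightarrow> jointly_surjective I (grad_Log z)"
    then show ?thesis
      by (intro exI[of _ N]) auto
  qed
qed

text \<open>A generic point over \<open>S\<close> has maximal rank and selects \<open>I\<close>.
  Near it the \<open>I\<close>-coordinates of the image fill an open set, so they can be made
  generic without leaving \<open>S\<close>. Every point of the fibre shares these coordinates and is
  therefore regular.\<close>

lemma ex_regular_fibre:
  assumes S: "openin (top_of_set (Log_P ` \<Omega>)) S" "S \<noteq> {}"
  obtains I x where "card I = min_sum" "x \<in> S"
    "\<And>y. y \<in> V \<Longrightarrow> y \<in> torus \<Longrightarrow> Log y = x \<Longrightarrow> jointly_surjective I (grad y)"
proof -
  define M where "M = \<Omega> \<inter> Log_P -` S"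
  have cont_Log_P: "continuous_on \<Omega> Log_P"
    by (intro continuous_at_imp_continuous_on ballI has_derivative_continuous[OF Log_P_has_derivative])
  obtain O' where O': "open O'" "S = Log_P ` \<Omega> \<inter> O'"
    using S(1) unfolding openin_open by metis
  have "M = \<Omega> \<inter> Log_P -` O'"
    using O'(2) by (auto simp: M_def)
  then have "open M"
    using continuous_open_preimage[OF cont_Log_P open_\<Omega> O'(1)] by simp
  have "M \<subseteq> \<Omega>"
    by (auto simp: M_def)
  have "M \<noteq> {}" "P ` M \<subseteq> torus"
    using S(2) O'(2) by (auto simp: M_def \<Omega>_def)
  then obtain y Q where y: "y \<in> M" "partition_on UNIV Q"
    "(\<Sum>B\<in>Q. 2 * proj_rank V B - 1) \<le> dim (span (range (grad (- \<i> *s P y))))"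
    using ex_generic_in_V[OF \<open>open M\<close>] by metis
  define c where "c = - \<i> *s P y"
  have "c \<in> V"
    unfolding c_def by (rule vec.subspace_scale[OF V P_in])
  then have Pc: "P c = c"
    by (rule P_id)
  have "c \<in> torus" "Log c = Log (P y)"
    using y(1) \<open>P ` M \<subseteq> torus\<close> by (auto simp: c_def torus_def Log_def norm_mult)
  then have "c \<in> M"
    using y(1) by (simp add: M_def \<Omega>_def Log_P_def Pc)
  \<comment> \<open>The upper bound valid for all partitions meets the lower bound coming from
    \<open>Q\<close>.\<close>
  have dim_c: "dim (range (grad c)) = min_sum"
    using dim_grad_le_min_sum[OF \<open>c \<in> V\<close> \<open>c \<in> torus\<close>] min_sum_le[OF y(2)] y(3) by (simp add: c_def)
  obtain B where B: "B \<subseteq> range (grad c)" "independent B" "card B = min_sum"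
    using basis_exists[of "range (grad c)"] dim_c by metis
  obtain I where I: "inj_on (grad c) I" "B = grad c ` I"
    using B(1) unfolding subset_image_inj by metis
  have card_I: "card I = min_sum"
    using B(3) card_image[OF I(1)] I(2) by simp
  have surj_c: "jointly_surjective I (grad_Log c)"
  proof (rule jointly_surjective_grad_Log)
    show "c \<in> \<Omega>"
      using \<open>c \<in> M\<close> \<open>M \<subseteq> \<Omega>\<close> by blast
    show "jointly_surjective I (grad (P c))"
      using jointly_surjective_if_independent[of "grad c" I] B(2) I by (simp add: Pc)
  qed
  have rank: "dim (span (range (grad_Log z))) \<le> card I" if "z \<in> M" for z
    using dim_grad_Log_le[of z] card_I that \<open>M \<subseteq> \<Omega>\<close> by auto
  have der: "(Log_P has_derivative (\<lambda>v. \<chi> i. v \<bullet> grad_Log z i)) (at z)" if "z \<in> M" for z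
    using Log_P_has_derivative that \<open>M \<subseteq> \<Omega>\<close> by blast
  have cont: "continuous_on M (\<lambda>z. grad_Log z i)" for i
    using continuous_on_grad_Log \<open>M \<subseteq> \<Omega>\<close> by (rule continuous_on_subset)
  obtain N where N: "open N" "c \<in> N" "N \<subseteq> M"
    "open {x. \<exists>z\<in>N. \<forall>i\<in>I. x $ i = Log_P z $ i}"
    by (rule constant_rank[OF \<open>open M\<close> der cont rank \<open>c \<in> M\<close> surj_c]) auto
  define pos where "pos = {q :: real ^ 'n. \<forall>i. 0 < q $ i}"
  \<comment> \<open>\<open>q\<close> plays the part of the squared moduli, so half of its logarithm
    is compared with \<open>Log\<close>. Only its coordinates in \<open>I\<close> are tied to a
    point of \<open>N\<close>.\<close>
  define h where "h q = (\<chi> i. ln (q $ i) / 2)" for q :: "real ^ 'n"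
  define Y where "Y = pos \<inter> h -` {x. \<exists>z\<in>N. \<forall>i\<in>I. x $ i = Log_P z $ i}"
  have "pos = (\<Inter>i. {q. 0 < q $ i})"
    by (auto simp: pos_def)
  moreover have "open {q :: real ^ 'n. 0 < q $ i}" for i
    by (intro open_Collect_less continuous_intros)
  ultimately have "open pos"
    by auto
  moreover have "continuous_on pos h"
    unfolding h_def
  proof (rule continuous_on_vec_lambda)
    fix i
    have "\<forall>q\<in>pos. q $ i \<noteq> 0"
      by (metis (lifting) less_irrefl mem_Collect_eq pos_def)
    then show "continuous_on pos (\<lambda>q. ln (q $ i) / 2)"
      by (intro continuous_on_divide continuous_on_ln continuous_on_component continuous_on_id
          continuous_on_const) simp_all
  qed
  ultimately have "open Y"
    unfolding Y_def using N(4) by (intro continuous_open_preimage)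
  have "(\<chi> i. exp (2 * Log_P c $ i)) \<in> Y"
    using N(2) by (auto simp: Y_def pos_def h_def)
  then obtain q where q: "q \<in> Y"
    "\<And>w. \<exists>D. derivation_on UNIV D \<and> (\<forall>y\<in>K. D y = 0) \<and> dmap D q = w"
    using ex_generic_point[OF \<open>open Y\<close> _ K] by (metis empty_iff)
  then obtain z where z: "z \<in> N" "\<And>i. i \<in> I \<Longrightarrow> ln (q $ i) / 2 = Log_P z $ i"
    by (auto simp: Y_def h_def)
  show thesis
  proof (rule that[OF card_I])
    show "Log_P z \<in> S"
      using z(1) N(3) by (auto simp: M_def)
    fix y assume y: "y \<in> V" "y \<in> torus" "Log y = Log_P z"
    show "jointly_surjective I (grad y)"
    proof (rule jointly_surjective_grad_generic_fibre[OF q(2) y(1)])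
      fix i assume "i \<in> I"
      then have "ln (q $ i) = 2 * ln (cmod (y $ i))"
        using z(2)[of i] y(3) by (simp add: Log_def vec_eq_iff)
      also have "\<dots> = ln ((cmod (y $ i))\<^sup>2)"
        using y(2) by (simp add: ln_realpow torus_def)
      finally show "q $ i = (cmod (y $ i))\<^sup>2"
        using q(1) y(2) by (subst (asm) ln_inj_iff) (auto simp: Y_def pos_def torus_def)
    qed
  qed
qed

text \<open>Properness of \<open>Log\<close> spreads the regularity of one whole fibre to all fibres
  over a relatively open part of \<open>S\<close>, where the chart construction applies.\<close>

lemma real_dim_amoeba: "real_dim (amoeba (V \<inter> torus)) = min_sum"
  unfolding amoeba_def Log_P_image[symmetric]
proof (rule real_dim_eqI)
  show "Log_P ` \<Omega> \<noteq> {}"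
    using ex_in_torus by (simp add: Log_P_image)
  have closed_V: "closed V"
    by (intro closed_subspace subspace_if_vec_subspace V)
  then have closed: "closed (Log_P ` \<Omega>)"
    unfolding Log_P_image by (rule closed_Log_image)
  fix S assume S: "openin (top_of_set (Log_P ` \<Omega>)) S" "S \<noteq> {}"
  obtain I x where I: "card I = min_sum" and x: "x \<in> S"
    "\<And>y. y \<in> V \<Longrightarrow> y \<in> torus \<Longrightarrow> Log y = x \<Longrightarrow> jointly_surjective I (grad y)"
    using ex_regular_fibre[OF S] by metis
  define R where "R = {z \<in> \<Omega>. jointly_surjective I (grad_Log z)}"
  \<comment> \<open>The amoeba points with at least one singular preimage. This set is closed
    because the singular points are closed in \<open>V\<close>, up to the coordinate hyperplanes,
    and \<open>Log\<close> is proper.\<close>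
  define E where "E = Log ` (V \<inter> - R \<inter> torus)"
  have "closed E"
    unfolding E_def using closed_V open_regular[OF I]
    by (intro closed_Log_image closed_Int) (simp_all add: R_def closed_def)
  then have "openin (top_of_set (Log_P ` \<Omega>)) (S \<inter> - E)"
    using openin_Int_open[OF S(1)] by (simp add: open_Compl)
  moreover have "x \<notin> E"
  proof
    assume "x \<in> E"
    then obtain y where y: "y \<in> V" "y \<notin> R" "y \<in> torus" "x = Log y"
      by (auto simp: E_def)
    have "y \<in> \<Omega>"
      using y by (simp add: \<Omega>_def P_id)
    moreover have "jointly_surjective I (grad (P y))"
      using x(2)[OF y(1,3)] y by (simp add: P_id)
    ultimately show False
      using y(2) jointly_surjective_grad_Log by (simp add: R_def)
  qed
  then have "S \<inter> - E \<noteq> {}"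
    using x(1) by blast
  moreover have "jointly_surjective I (grad_Log z)" if z: "z \<in> \<Omega>" "Log_P z \<in> S \<inter> - E" for z
  proof -
    have "P z \<in> R"
      using z P_in by (auto simp: E_def Log_P_def \<Omega>_def)
    moreover have "grad_Log (P z) = grad_Log z"
      by (simp add: grad_Log_def P_idem fun_eq_iff)
    ultimately show ?thesis
      by (simp add: R_def)
  qed
  moreover have "dim (span (range (grad_Log z))) \<le> card I" if "z \<in> \<Omega>" for z
    using dim_grad_Log_le[OF that] I by simp
  ultimately have "\<exists>T\<subseteq>S \<inter> - E. T \<noteq> {} \<and> openin (top_of_set (Log_P ` \<Omega>)) T \<and> chart (card I) T"
    by (intro ex_chart_in_image[OF open_\<Omega> Log_P_has_derivative continuous_on_grad_Log _ closed]) 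
  then show "\<exists>T\<subseteq>S. T \<noteq> {} \<and> openin (top_of_set (Log_P ` \<Omega>)) T \<and> chart min_sum T"
    unfolding I by blast
qed

text \<open>No coordinate vanishes identically on \<open>V\<close>, so a nonempty block carries a
  nonzero functional. This is what identifies natural with integer subtraction in the final
  formula.\<close>

lemma proj_rank_pos:
  assumes "B \<noteq> {}"
  shows "0 < proj_rank V B"
proof -
  obtain i where i: "i \<in> B"
    using assms by blast
  obtain v where v: "v \<in> V" "v $ i \<noteq> 0"
    using coord_nonzero by blast
  have "P (axis i (v $ i)) \<bullet> v \<noteq> 0"
    using v by (simp add: inner_P_axis P_id)
  moreover have "P (axis i (v $ i)) \<in> flat B"
    unfolding flat_def using i by (intro span_base) auto
  ultimately have "\<not> flat B \<subseteq> {0}"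
    by auto
  then have "dim (flat B) \<noteq> 0"
    by (simp add: dim_eq_0)
  then show ?thesis
    by (simp add: dim_flat)
qed

lemma min_sum_eq:
  "int min_sum = Min {(\<Sum>B\<in>Q. 2 * int (proj_rank V B) - 1) | Q. partition_on UNIV Q}"
proof -
  let ?S = "\<lambda>Q. \<Sum>B\<in>Q. 2 * proj_rank V B - 1"
  have fin: "finite {Q. partition_on (UNIV :: 'n set) Q}"
    by (intro finitely_many_partition_on) simp
  have ne: "{Q. partition_on (UNIV :: 'n set) Q} \<noteq> {}"
    using partition_on_space[of "UNIV :: 'n set"] by auto
  have S: "int (?S Q) = (\<Sum>B\<in>Q. 2 * int (proj_rank V B) - 1)" if Q: "partition_on UNIV Q" for Q
    unfolding of_nat_sum
  proof (rule sum.cong[OF refl])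
    fix B assume "B \<in> Q"
    then have "0 < proj_rank V B"
      using partition_onD3[OF Q] by (intro proj_rank_pos) auto
    then show "int (2 * proj_rank V B - 1) = 2 * int (proj_rank V B) - 1"
      by (simp add: of_nat_diff)
  qed
  have "int min_sum = Min (int ` ?S ` {Q. partition_on UNIV Q})"
    unfolding min_sum_def using fin ne by (intro mono_Min_commute) (auto intro: monoI)
  also have "int ` ?S ` {Q. partition_on UNIV Q} =
      {(\<Sum>B\<in>Q. 2 * int (proj_rank V B) - 1) | Q. partition_on UNIV Q}"
    using S unfolding image_image by (auto simp del: of_nat_sum intro!: image_eqI)
  finally show ?thesis .
qed

end

theorem theorem1p1:
  fixes V X :: "(complex ^ 'n) set"
  assumes "vec.subspace V"
    and "\<And>i. \<not> V \<subseteq> {z. z $ i = 0}"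
    and "X = V \<inter> torus"
  shows "int (real_dim (amoeba X)) =
           Min {(\<Sum>B\<in>P. 2 * int (proj_rank V B) - 1) | P. partition_on UNIV P}"
proof (rule ex_orthogonal_projection[OF subspace_if_vec_subspace[OF assms(1)]])
  fix P K
  assume P: "linear P" "\<And>x. P x \<in> V" "\<And>v. v \<in> V \<Longrightarrow> P v = v"
    "\<And>x y. P x \<bullet> y = x \<bullet> P y" "countable K"
    "\<And>D x. derivation_on UNIV D \<Longrightarrow> (\<And>y. y \<in> K \<Longrightarrow> D y = 0) \<Longrightarrow> dmap D (P x) = P (dmap D x)"
  have nonzero: "\<exists>v\<in>V. v $ i \<noteq> 0" for i
    using assms(2)[of i] by auto
  interpret linear_amoeba V P K
    using assms(1) nonzero P by (rule linear_amoeba.intro)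
  show ?thesis
    unfolding assms(3) real_dim_amoeba by (rule min_sum_eq)
qed

end
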